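(* Assume that the coloring property $\mathsf E(a,b)$ holds for some $a,b>0$, and set $$A=4+4a,\qquad h=\frac{4A\log2}{b},\qquad C_{a,b}=\max\Bigl\{2,\,h+\frac{4}{3a}\Bigr\}.$$ Let $A_1,\dots,A_n$ be real symmetric $d\times d$ matrices with $$v:=\Bigl\|\sum_iA_i^2\Bigr\|\le\frac a4,\qquad q:=\max_i\operatorname{tr}(A_i^2)\le\frac{b}{2A},$$ and let $S_x=\sum_{i=1}^nx_iA_i$ and $\tau=\sum_i\operatorname{tr}(A_i^2)$. Then, for every $\beta>0$, $$\mathbb E_{x\sim U_n}W_\beta(S_x)\ge\exp\{-C_{a,b}\max(1,\beta)\tau\}.$$ Moreover, if additionally $\tau\ge\frac12$, then with $G=\bigl\{x\in\{-1,1\}^n:\|S_x\|\le\tfrac12,\ \operatorname{tr}(S_x^2)\le\tfrac\tau a\bigr\}$, $$\mathbb P_{x\sim U_n}(x\in G)\ge e^{-h\tau},$$ and the conditional law $\mu=U_n(\,\cdot\,|\,G)$ satisfies $$D(\mu\|U_n)\le h\tau,\qquad\mathbb E_{x\sim\mu}\Phi(S_x)\le\frac{4\tau}{3a}.$$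
   Context: $\|\cdot\|$ is the operator norm, $U_n$ the uniform distribution on $\{-1,1\}^n$, $D(\cdot\|\cdot)$ relative entropy (natural logarithm). For symmetric $H$, $\Phi(H)=-\log\det(I-H^2)$ and $W_\beta(H)=e^{-\beta\Phi(H)}=\det(I-H^2)^\beta$ if $\|H\|<1$, while $\Phi(H)=+\infty$ and $W_\beta(H)=0$ if $\|H\|\ge1$. For $a,b>0$, the property $\mathsf E(a,b)$ holds if every finite family of real symmetric matrices $C_1,\dots,C_N$, in arbitrary matrix dimension, satisfying $\|\sum_iC_i^2\|\le a$ and $\max_i\operatorname{tr}(C_i^2)\le b$ admits a coloring $x\in\{-1,1\}^N$ such that $\|\sum_ix_iC_i\|\le1$. *)

theory Defs
  imports "HOL-Probability.Probability" "Jordan_Normal_Form.Determinant"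
begin

text \<open>
  The coloring property quantifies over the matrix dimension, so matrices are taken from
  Jordan_Normal_Form, where the dimension is a value (\<open>carrier_mat d d\<close>).
  Both imports provide a constant named \<open>det\<close>; the one meant here is always qualified.
\<close>

definition symmetric_mat :: "nat \<Rightarrow> real mat \<Rightarrow> bool" where
  "symmetric_mat d H \<longleftrightarrow> H \<in> carrier_mat d d \<and> transpose_mat H = H"

definition mat_trace :: "real mat \<Rightarrow> real" where
  "mat_trace H = (\<Sum>i<dim_row H. H $$ (i, i))"

definition eucl_norm :: "real vec \<Rightarrow> real" where
  "eucl_norm v = sqrt (scalar_prod v v)"

text \<open>
  The set contains \<open>0\<close> and is bounded above, so \<open>Sup\<close> is a genuine supremum; for the empty
  matrix the value is \<open>0\<close>.
\<close>
definition op_norm :: "real mat \<Rightarrow> real" where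
  "op_norm H = Sup {eucl_norm (H *\<^sub>v v) | v. v \<in> carrier_vec (dim_col H) \<and> eucl_norm v \<le> 1}"

text \<open>Matrices of different dimension share one type, so \<open>sum\<close> is not available for them.\<close>
definition mat_sum :: "nat \<Rightarrow> nat \<Rightarrow> (nat \<Rightarrow> real mat) \<Rightarrow> real mat" where
  "mat_sum d n F = mat d d (\<lambda>(r, c). \<Sum>i<n. F i $$ (r, c))"

definition signed_sum :: "nat \<Rightarrow> nat \<Rightarrow> (nat \<Rightarrow> real mat) \<Rightarrow> (nat \<Rightarrow> real) \<Rightarrow> real mat" where
  "signed_sum d n F x = mat_sum d n (\<lambda>i. x i \<cdot>\<^sub>m F i)"

definition sign_cube :: "nat \<Rightarrow> (nat \<Rightarrow> real) set" where
  "sign_cube n = {..<n} \<rightarrow>\<^sub>E {-1, 1}"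

definition unif_cube :: "nat \<Rightarrow> (nat \<Rightarrow> real) pmf" where
  "unif_cube n = pmf_of_set (sign_cube n)"

definition Phi :: "real mat \<Rightarrow> ereal" where
  "Phi H = (if op_norm H < 1
            then ereal (- ln (Determinant.det (1\<^sub>m (dim_row H) - H * H)))
            else \<infinity>)"

text \<open>
  For symmetric \<open>H\<close> with \<open>op_norm H < 1\<close> all eigenvalues of \<open>I - H\<^sup>2\<close> lie in
  \<open>(0, 1]\<close>, so the determinant is in \<open>(0, 1]\<close>: the logarithm in \<open>Phi\<close> and the real power
  below have a positive argument, and \<open>Phi H \<ge> 0\<close>.
\<close>
definition W :: "real \<Rightarrow> real mat \<Rightarrow> real" where
  "W \<beta> H = (if op_norm H < 1
            then Determinant.det (1\<^sub>m (dim_row H) - H * H) powr \<beta>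
            else 0)"

lemma W_eq_exp_Phi:
  assumes "op_norm H < 1" "Determinant.det (1\<^sub>m (dim_row H) - H * H) > 0"
  shows "W \<beta> H = exp (- \<beta> * real_of_ereal (Phi H))"
  using assms by (simp add: W_def Phi_def powr_def)

text \<open>The bound on the maximum over \<open>i\<close> is vacuous for the empty family.\<close>
definition coloring_property :: "real \<Rightarrow> real \<Rightarrow> bool" where
  "coloring_property a b \<longleftrightarrow>
    (\<forall>d N C. (\<forall>i<N. symmetric_mat d (C i)) \<longrightarrow>
       op_norm (mat_sum d N (\<lambda>i. C i * C i)) \<le> a \<longrightarrow>
       (\<forall>i<N. mat_trace (C i * C i) \<le> b) \<longrightarrow>
       (\<exists>x\<in>sign_cube N. op_norm (signed_sum d N C x) \<le> 1))"

text \<open>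
  Relative entropy with natural logarithm: \<open>KL_divergence\<close> takes the base measure first, and
  base \<open>exp 1\<close> makes its \<open>log\<close> equal to \<open>ln\<close>. It is real-valued, which is adequate as long as
  \<open>p\<close> is absolutely continuous with respect to \<open>q\<close>.
\<close>
definition rel_entropy :: "'a pmf \<Rightarrow> 'a pmf \<Rightarrow> real" where
  "rel_entropy p q = KL_divergence (exp 1) (measure_pmf q) (measure_pmf p)"

text \<open>
  Expectation of a nonnegative, possibly infinite function; \<open>e2ennreal\<close> sends negative values
  to \<open>0\<close>, so this must not be used for functions that change sign.
\<close>
definition ext_expectation :: "'a pmf \<Rightarrow> ('a \<Rightarrow> ereal) \<Rightarrow> ennreal" where
  "ext_expectation p f = (\<integral>\<^sup>+ x. e2ennreal (f x) \<partial>measure_pmf p)"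

end

theory Submission
  imports Defs "Jordan_Normal_Form.Schur_Decomposition"
begin

text \<open>
  \<^bold>\<open>From one coloring to many.\<close> The coloring property supplies a single sign vector, whereas the
  claim is about a proportion of the cube. Let \<open>good\<close> be the set of sign vectors \<open>x\<close> with
  \<open>\<parallel>\<Sum>\<^sub>i x\<^sub>i C\<^sub>i\<parallel> \<le> 1\<close>, and fix arbitrary sign vectors \<open>z\<^sub>0, \<dots>, z\<^sub>R\<^sub>-\<^sub>1\<close>. A coloring of the direct sums
  \<open>\<Oplus>\<^sub>k z\<^sub>k\<^sub>,\<^sub>i C\<^sub>i\<close> is one vector \<open>y\<close> for which all the products \<open>y z\<^sub>k\<close> are in \<open>good\<close>. Direct sums leave
  \<open>\<parallel>\<Sum>\<^sub>i C\<^sub>i\<^sup>2\<parallel>\<close> unchanged and only add up the traces \<open>t\<^sub>i = tr(C\<^sub>i\<^sup>2)\<close>, so the sign \<open>y\<^sub>i\<close> can be shared by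
  about \<open>b / t\<^sub>i\<close> copies, and \<open>m\<^sub>i \<approx> 2 R t\<^sub>i / b\<close> separate signs for each index \<open>i\<close> are enough for all
  \<open>R\<close> copies (lemma \<open>shared_coloring\<close>). Hence each of the \<open>2\<^bsup>nR\<^esup>\<close> tuples \<open>z\<close> arises from a tuple of
  good vectors through one of \<open>2\<^bsup>\<Sum>m\<^sub>i\<^esup>\<close> sign patterns. So \<open>2\<^bsup>nR\<^esup> \<le> 2\<^bsup>\<Sum>m\<^sub>i\<^esup> \<bar>good\<bar>\<^sup>R\<close>, and letting \<open>R\<close>
  grow gives \<open>\<bar>good\<bar> / 2\<^sup>n \<ge> 2\<^bsup>-2 \<Sum>t\<^sub>i / b\<^esup>\<close> (\<open>many_colorings\<close>).

  \<^bold>\<open>The set \<open>G\<close>.\<close> Apply this to \<open>C\<^sub>i = 2 A\<^sub>i \<oplus> N\<^sub>i\<close>, where \<open>N\<^sub>i\<close> is the symmetric matrix whose only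
  nonzero entries are a copy of the vector \<open>(a/\<tau>)\<^bsup>1/2\<^esup> vec(A\<^sub>i)\<close> in its first row and column. A signed
  sum of the \<open>N\<^sub>i\<close> has norm \<open>(a/\<tau>)\<^bsup>1/2\<^esup> tr(S\<^sub>x\<^sup>2)\<^bsup>1/2\<^esup>\<close>, so being good means being in \<open>G\<close>; and
  \<open>\<tau> \<ge> 1/2\<close> gives \<open>tr(C\<^sub>i\<^sup>2) \<le> (4 + 4a) tr(A\<^sub>i\<^sup>2)\<close> (\<open>many_balanced_colorings\<close>). The relative
  entropy of the conditional law is \<open>-ln P(G)\<close>, and on \<open>G\<close> all eigenvalues of \<open>S\<^sub>x\<^sup>2\<close> are at most
  \<open>1/4\<close>, where \<open>-ln (1 - s) \<le> 4s/3\<close>; this bounds \<open>\<Phi>(S\<^sub>x)\<close> by \<open>4/3 tr(S\<^sub>x\<^sup>2)\<close>. The weight bound for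
  \<open>\<tau> \<ge> 1/2\<close> follows by restricting the expectation to \<open>G\<close>.

  \<^bold>\<open>Small \<open>\<tau>\<close>.\<close> If \<open>\<tau> < 1/2\<close>, then \<open>W\<^sub>1(S\<^sub>x) \<ge> 1 - tr(S\<^sub>x\<^sup>2)\<close>, and \<open>tr(S\<^sub>x\<^sup>2)\<close> has mean \<open>\<tau>\<close>, so
  \<open>W\<^sub>1(S\<^sub>x)\<close> has mean at least \<open>1 - \<tau> \<ge> e\<^bsup>-2\<tau>\<^esup>\<close>; convexity of powers extends this to \<open>\<beta> \<ge> 1\<close>
  and \<open>W\<^sub>\<beta> \<ge> W\<^sub>1\<close> to \<open>\<beta> \<le> 1\<close> (\<open>W_expectation_small_energy\<close>).
\<close>

section \<open>Operator norm bounds over arbitrary index sets\<close>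

text \<open>
  The inequality \<open>\<parallel>M\<parallel> \<le> \<bar>c\<bar>\<close> for a matrix with rows and columns indexed by any finite set, which
  lets direct sums and bordered matrices be indexed by pairs and options.
\<close>
definition op_bound :: "'i set \<Rightarrow> ('i \<Rightarrow> 'i \<Rightarrow> real) \<Rightarrow> real \<Rightarrow> bool" where
  "op_bound I M c \<longleftrightarrow>
    (\<forall>f. (\<Sum>r\<in>I. (\<Sum>s\<in>I. M r s * f s)\<^sup>2) \<le> c\<^sup>2 * (\<Sum>s\<in>I. (f s)\<^sup>2))"

lemma op_boundD:
  "op_bound I M c \<Longrightarrow> (\<Sum>r\<in>I. (\<Sum>s\<in>I. M r s * f s)\<^sup>2) \<le> c\<^sup>2 * (\<Sum>s\<in>I. (f s)\<^sup>2)"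
  by (simp add: op_bound_def)

lemma op_bound_cong:
  assumes "\<And>r s. r \<in> I \<Longrightarrow> s \<in> I \<Longrightarrow> M r s = M' r s"
  shows "op_bound I M c \<longleftrightarrow> op_bound I M' c"
proof -
  have "(\<Sum>r\<in>I. (\<Sum>s\<in>I. M r s * f s)\<^sup>2) = (\<Sum>r\<in>I. (\<Sum>s\<in>I. M' r s * f s)\<^sup>2)" for f
    using assms by (intro sum.cong arg_cong[of _ _ "\<lambda>x. x\<^sup>2"]) auto
  then show ?thesis by (simp add: op_bound_def)
qed

lemma op_bound_mono:
  assumes "op_bound I M c" "c\<^sup>2 \<le> c'\<^sup>2"
  shows "op_bound I M c'"
  unfolding op_bound_def
proof
  fix f
  have "c\<^sup>2 * (\<Sum>s\<in>I. (f s)\<^sup>2) \<le> c'\<^sup>2 * (\<Sum>s\<in>I. (f s)\<^sup>2)"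
    using assms(2) by (intro mult_right_mono sum_nonneg) auto
  with op_boundD[OF assms(1), of f]
  show "(\<Sum>r\<in>I. (\<Sum>s\<in>I. M r s * f s)\<^sup>2) \<le> c'\<^sup>2 * (\<Sum>s\<in>I. (f s)\<^sup>2)" by linarith
qed

lemma op_bound_frobenius:
  "op_bound I M (sqrt (\<Sum>r\<in>I. \<Sum>s\<in>I. (M r s)\<^sup>2))"
proof -
  have "(\<Sum>r\<in>I. (\<Sum>s\<in>I. M r s * f s)\<^sup>2) \<le> (\<Sum>r\<in>I. (\<Sum>s\<in>I. (M r s)\<^sup>2) * (\<Sum>s\<in>I. (f s)\<^sup>2))" for f
    by (intro sum_mono Cauchy_Schwarz_ineq_sum)
  then show ?thesis
    unfolding op_bound_def by (simp add: sum_distrib_right sum_nonneg)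
qed

lemma op_bound_scale:
  assumes "op_bound I M c"
  shows "op_bound I (\<lambda>r s. k * M r s) (k * c)"
proof -
  have "(\<Sum>r\<in>I. (\<Sum>s\<in>I. k * M r s * f s)\<^sup>2) = k\<^sup>2 * (\<Sum>r\<in>I. (\<Sum>s\<in>I. M r s * f s)\<^sup>2)" for f
    by (simp add: sum_distrib_left[symmetric] mult.assoc power_mult_distrib)
  then show ?thesis
    using assms unfolding op_bound_def by (simp add: power_mult_distrib mult.assoc mult_left_mono)
qed

lemma eucl_norm_eq: "v \<in> carrier_vec d \<Longrightarrow> eucl_norm v = sqrt (\<Sum>i<d. (vec_index v i)\<^sup>2)"
  by (auto simp: eucl_norm_def scalar_prod_def power2_eq_square lessThan_atLeast0)

lemma eucl_norm_mult_mat_vec: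
  assumes "M \<in> carrier_mat d d" "v \<in> carrier_vec d"
  shows "eucl_norm (M *\<^sub>v v) = sqrt (\<Sum>r<d. (\<Sum>s<d. M $$ (r, s) * vec_index v s)\<^sup>2)"
proof -
  have "vec_index (M *\<^sub>v v) r = (\<Sum>s<d. M $$ (r, s) * vec_index v s)" if "r < d" for r
    using assms that by (auto simp: scalar_prod_def lessThan_atLeast0)
  moreover have "M *\<^sub>v v \<in> carrier_vec d" using assms by auto
  ultimately show ?thesis by (simp add: eucl_norm_eq)
qed

text \<open>Normalising a vector turns the supremum over the unit ball into a homogeneous inequality.\<close>
lemma op_norm_le_iff:
  assumes M: "M \<in> carrier_mat d d" and c: "c \<ge> 0"
  shows "op_norm M \<le> c \<longleftrightarrow> op_bound {..<d} (\<lambda>r s. M $$ (r, s)) c"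
proof -
  let ?E = "\<lambda>r s. M $$ (r, s)"
  let ?N = "\<lambda>f. sqrt (\<Sum>s<d. (f s)\<^sup>2)" and ?A = "\<lambda>f r. \<Sum>s<d. ?E r s * f s"
  let ?U = "{eucl_norm (M *\<^sub>v v) | v. v \<in> carrier_vec (dim_col M) \<and> eucl_norm v \<le> 1}"
  have U: "?U = {?N (?A f) | f. ?N f \<le> 1}"
  proof (intro equalityI subsetI)
    fix x assume "x \<in> ?U"
    then obtain v where "v \<in> carrier_vec d" "eucl_norm v \<le> 1" "x = eucl_norm (M *\<^sub>v v)"
      using M by auto
    then show "x \<in> {?N (?A f) | f. ?N f \<le> 1}"
      using M by (auto simp: eucl_norm_mult_mat_vec eucl_norm_eq intro!: exI[of _ "vec_index v"])
  next
    fix x assume "x \<in> {?N (?A f) | f. ?N f \<le> 1}"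
    then obtain f where f: "?N f \<le> 1" "x = ?N (?A f)" by blast
    have "eucl_norm (Matrix.vec d f) = ?N f"
      by (subst eucl_norm_eq[of _ d]) auto
    moreover have "eucl_norm (M *\<^sub>v Matrix.vec d f) = ?N (?A f)"
      using M by (subst eucl_norm_mult_mat_vec[of _ d]) auto
    ultimately show "x \<in> ?U" using M f by (auto intro!: exI[of _ "Matrix.vec d f"])
  qed
  have bd: "?N (?A f) \<le> k * ?N f" if "op_bound {..<d} ?E k" "k \<ge> 0" for f k
    using real_sqrt_le_mono[OF op_boundD[OF that(1), of f]] that(2)
    by (simp add: real_sqrt_mult)
  have le: "x \<le> k" if x: "x \<in> ?U" and k: "op_bound {..<d} ?E k" "k \<ge> 0" for x k
  proof -
    obtain f where f: "?N f \<le> 1" "x = ?N (?A f)" using x unfolding U by blast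
    show ?thesis using bd[OF k, of f] mult_left_mono[OF f(1) k(2)] f(2) by simp
  qed
  have ne: "?U \<noteq> {}" unfolding U by (auto intro!: exI[of _ "\<lambda>_. 0"])
  show ?thesis
  proof
    assume "op_bound {..<d} ?E c"
    then show "op_norm M \<le> c"
      unfolding op_norm_def using le c ne by (intro cSup_least) auto
  next
    assume *: "op_norm M \<le> c"
    have bdd: "bdd_above ?U"
      by (rule bdd_aboveI, rule le[OF _ op_bound_frobenius]) (auto intro!: sum_nonneg)
    show "op_bound {..<d} ?E c"
      unfolding op_bound_def
    proof
      fix f :: "nat \<Rightarrow> real"
      show "(\<Sum>r<d. (?A f r)\<^sup>2) \<le> c\<^sup>2 * (\<Sum>s<d. (f s)\<^sup>2)"
      proof (cases "?N f = 0")
        case True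
        then have "f s = 0" if "s < d" for s using that by (auto simp: sum_nonneg_eq_0_iff)
        then show ?thesis by simp
      next
        case False
        then have pos: "?N f > 0" by (simp add: order_less_le sum_nonneg)
        define g where "g s = f s / ?N f" for s
        have Ng: "?N g = 1"
          using False by (simp add: g_def power_divide sum_divide_distrib[symmetric] sum_nonneg)
        have "?N (?A g) \<in> ?U" unfolding U using Ng by auto
        then have "?N (?A g) \<le> c"
          using * cSup_upper[OF _ bdd] unfolding op_norm_def by force
        moreover have "?A g r = ?A f r / ?N f" for r
          by (simp add: g_def sum_divide_distrib)
        then have "?N (?A g) = ?N (?A f) / ?N f"
          using False by (simp add: power_divide sum_divide_distrib[symmetric] real_sqrt_divide sum_nonneg)
        ultimately have "?N (?A f) \<le> c * ?N f" using pos by (simp add: field_simps)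
        then have "(?N (?A f))\<^sup>2 \<le> (c * ?N f)\<^sup>2" by (intro power_mono) (auto simp: sum_nonneg)
        then show ?thesis by (simp add: power_mult_distrib sum_nonneg)
      qed
    qed
  qed
qed


text \<open>Cauchy--Schwarz; in matrix terms, \<open>\<parallel>\<Sum>\<^sub>i w\<^sub>i w\<^sub>i\<^sup>T\<parallel> \<le> \<Sum>\<^sub>i \<parallel>w\<^sub>i\<parallel>\<^sup>2\<close>.\<close>
lemma op_bound_outer_products:
  assumes "finite J"
  shows "op_bound I (\<lambda>p q. \<Sum>i\<in>J. w i p * w i q) (\<Sum>i\<in>J. \<Sum>p\<in>I. (w i p)\<^sup>2)"
proof -
  have "(\<Sum>p\<in>I. \<Sum>q\<in>I. (\<Sum>i\<in>J. w i p * w i q)\<^sup>2)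
      \<le> (\<Sum>p\<in>I. \<Sum>q\<in>I. (\<Sum>i\<in>J. (w i p)\<^sup>2) * (\<Sum>i\<in>J. (w i q)\<^sup>2))"
    by (intro sum_mono Cauchy_Schwarz_ineq_sum)
  also have "\<dots> = (\<Sum>i\<in>J. \<Sum>p\<in>I. (w i p)\<^sup>2)\<^sup>2"
    by (simp add: power2_eq_square sum_product[symmetric] sum.swap[of _ I J])
  finally have le: "(\<Sum>p\<in>I. \<Sum>q\<in>I. (\<Sum>i\<in>J. w i p * w i q)\<^sup>2) \<le> \<dots>" .
  show ?thesis
    by (rule op_bound_mono[OF op_bound_frobenius]) (use le in \<open>simp add: sum_nonneg\<close>)
qed

section \<open>Entries of symmetric matrices and of signed sums\<close>

lemma symmetric_mat_entry:
  assumes "symmetric_mat d H" "r < d" "s < d"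
  shows "H $$ (r, s) = H $$ (s, r)"
  using assms unfolding symmetric_mat_def by (metis carrier_matD index_transpose_mat(1))

lemma mat_mult_entry:
  assumes "M \<in> carrier_mat d d" "N \<in> carrier_mat d d" "r < d" "s < d"
  shows "(M * N) $$ (r, s) = (\<Sum>t<d. M $$ (r, t) * N $$ (t, s))"
  using assms by (auto simp: scalar_prod_def lessThan_atLeast0)

lemma mat_trace_square:
  assumes "symmetric_mat d H"
  shows "mat_trace (H * H) = (\<Sum>r<d. \<Sum>s<d. (H $$ (r, s))\<^sup>2)"
proof -
  have H: "H \<in> carrier_mat d d" using assms by (simp add: symmetric_mat_def)
  have "mat_trace (H * H) = (\<Sum>r<d. (H * H) $$ (r, r))"
    using H by (simp add: mat_trace_def)
  also have "\<dots> = (\<Sum>r<d. \<Sum>s<d. (H $$ (r, s))\<^sup>2)"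
    using H symmetric_mat_entry[OF assms]
    by (intro sum.cong refl) (simp add: mat_mult_entry power2_eq_square del: index_mult_mat)
  finally show ?thesis .
qed

lemma sign_square_one: "y i * y i = 1" if "y \<in> J \<rightarrow>\<^sub>E {-1, 1::real}" "i \<in> J"
proof -
  have "y i \<in> {-1, 1}" using that by (rule PiE_mem)
  then show ?thesis by auto
qed

lemma finite_sign_cube [simp]: "finite (sign_cube n)"
  by (auto simp: sign_cube_def intro!: finite_PiE)

lemma card_sign_cube: "card (sign_cube n) = 2 ^ n"
  by (simp add: sign_cube_def card_funcsetE numeral_2_eq_2)

lemma sign_cube_nonempty [simp]: "sign_cube n \<noteq> {}"
  using card_sign_cube[of n] by fastforce

lemma mat_sum_carrier [simp]: "mat_sum d n F \<in> carrier_mat d d"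
  by (simp add: mat_sum_def)

lemma signed_sum_carrier [simp]: "signed_sum d n F x \<in> carrier_mat d d"
  by (simp add: signed_sum_def)

lemma signed_sum_entry:
  assumes "\<And>i. i < n \<Longrightarrow> F i \<in> carrier_mat d d" "r < d" "s < d"
  shows "signed_sum d n F x $$ (r, s) = (\<Sum>i<n. x i * F i $$ (r, s))"
proof -
  have "(x i \<cdot>\<^sub>m F i) $$ (r, s) = x i * F i $$ (r, s)" if "i < n" for i
    using assms(2,3) carrier_matD[OF assms(1)[OF that]] by auto
  then show ?thesis using assms by (simp add: signed_sum_def mat_sum_def)
qed

lemma signed_sum_symmetric:
  assumes "\<And>i. i < n \<Longrightarrow> symmetric_mat d (A i)"
  shows "symmetric_mat d (signed_sum d n A x)"
proof -
  have C: "A i \<in> carrier_mat d d" if "i < n" for i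
    using assms[OF that] by (simp add: symmetric_mat_def)
  have "signed_sum d n A x $$ (s, r) = signed_sum d n A x $$ (r, s)" if "r < d" "s < d" for r s
    using that symmetric_mat_entry[OF assms that] by (simp add: signed_sum_entry[OF C])
  moreover note carrier_matD[OF signed_sum_carrier[of d n A x]]
  ultimately show ?thesis
    unfolding symmetric_mat_def by (intro conjI eq_matI) auto
qed

section \<open>The spectrum of a real symmetric matrix\<close>

text \<open>
  If \<open>f + \<i> g\<close> is a complex eigenvector with eigenvalue \<open>\<alpha> + \<i> \<beta>\<close>, then
  \<open>\<langle>H f, g\<rangle> = \<langle>f, H g\<rangle>\<close> gives \<open>\<beta> (\<bar>f\<bar>\<^sup>2 + \<bar>g\<bar>\<^sup>2) = 0\<close>.
  With \<open>\<beta> = 0\<close> both \<open>f\<close> and \<open>g\<close> satisfy the real eigenvalue equation.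
\<close>
lemma symmetric_eigenvalue_real:
  assumes H: "symmetric_mat d H"
    and ev: "eigenvalue (map_mat complex_of_real H) z"
    and bound: "op_bound {..<d} (\<lambda>r s. H $$ (r, s)) c"
  shows "Im z = 0 \<and> \<bar>Re z\<bar> \<le> \<bar>c\<bar>"
proof -
  have C: "H \<in> carrier_mat d d" using H by (simp add: symmetric_mat_def)
  obtain v where v: "v \<in> carrier_vec d" "v \<noteq> 0\<^sub>v d"
    and eq: "map_mat complex_of_real H *\<^sub>v v = z \<cdot>\<^sub>v v"
    using ev C by (auto simp: eigenvalue_def eigenvector_def)
  define f g where "f r = Re (vec_index v r)" and "g r = Im (vec_index v r)" for r
  let ?H = "\<lambda>f r. \<Sum>s<d. H $$ (r, s) * f s"
  have comp: "(\<Sum>s<d. complex_of_real (H $$ (r, s)) * vec_index v s) = z * vec_index v r" if "r < d" for r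
    using arg_cong[OF eq, of "\<lambda>w. vec_index w r"] that v C
    by (simp add: scalar_prod_def lessThan_atLeast0)
  have Hf: "?H f r = Re z * f r - Im z * g r" if "r < d" for r
    using arg_cong[OF comp[OF that], of Re] by (simp add: f_def g_def)
  have Hg: "?H g r = Re z * g r + Im z * f r" if "r < d" for r
    using arg_cong[OF comp[OF that], of Im] by (simp add: f_def g_def)
  obtain r0 where r0: "r0 < d" "vec_index v r0 \<noteq> 0"
    using v by (metis carrier_vecD eq_vecI index_zero_vec)
  have nz: "f r0 \<noteq> 0 \<or> g r0 \<noteq> 0"
    using r0 by (auto simp: f_def g_def complex_eq_iff)
  have pos: "(\<Sum>r<d. (f r)\<^sup>2 + (g r)\<^sup>2) > 0"
    using r0 nz by (intro sum_pos2[of _ r0]) (auto simp: sum_power2_gt_zero_iff)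
  have "(\<Sum>r<d. ?H f r * g r) = (\<Sum>r<d. f r * ?H g r)"
    unfolding sum_distrib_left sum_distrib_right
    by (subst sum.swap, intro sum.cong refl) (simp add: symmetric_mat_entry[OF H] mult_ac)
  then have "(\<Sum>r<d. (Re z * f r - Im z * g r) * g r) = (\<Sum>r<d. f r * (Re z * g r + Im z * f r))"
    by (simp add: Hf Hg)
  then have "Im z * (\<Sum>r<d. (f r)\<^sup>2 + (g r)\<^sup>2) = 0"
    by (simp add: algebra_simps sum.distrib sum_subtractf sum_distrib_left power2_eq_square)
  then have im: "Im z = 0" using pos by simp
  have "(\<Sum>r<d. (?H f r)\<^sup>2) = (\<Sum>r<d. (Re z)\<^sup>2 * (f r)\<^sup>2)"
       "(\<Sum>r<d. (?H g r)\<^sup>2) = (\<Sum>r<d. (Re z)\<^sup>2 * (g r)\<^sup>2)"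
    by (intro sum.cong refl; simp add: Hf Hg im power_mult_distrib)+
  then have "(Re z)\<^sup>2 * (\<Sum>r<d. (f r)\<^sup>2 + (g r)\<^sup>2) \<le> c\<^sup>2 * (\<Sum>r<d. (f r)\<^sup>2 + (g r)\<^sup>2)"
    using op_boundD[OF bound, of f] op_boundD[OF bound, of g]
    by (simp add: sum.distrib distrib_left sum_distrib_left)
  then have "(Re z)\<^sup>2 \<le> c\<^sup>2" using pos by simp
  then show ?thesis using im by (simp add: abs_le_square_iff)
qed

lemma trace_mult_comm:
  fixes M N :: "'a::comm_semiring_0 mat"
  assumes "M \<in> carrier_mat d d" "N \<in> carrier_mat d d"
  shows "(\<Sum>r<d. (M * N) $$ (r, r)) = (\<Sum>r<d. (N * M) $$ (r, r))"
proof -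
  have "(\<Sum>r<d. (M * N) $$ (r, r)) = (\<Sum>r<d. \<Sum>s<d. M $$ (r, s) * N $$ (s, r))"
    using assms by (auto simp: scalar_prod_def lessThan_atLeast0)
  also have "\<dots> = (\<Sum>s<d. \<Sum>r<d. M $$ (r, s) * N $$ (s, r))" by (rule sum.swap)
  also have "\<dots> = (\<Sum>r<d. (N * M) $$ (r, r))"
    using assms by (auto simp: scalar_prod_def lessThan_atLeast0 mult.commute intro!: sum.cong)
  finally show ?thesis .
qed

lemma upper_triangular_square:
  fixes B :: "'a::comm_ring_1 mat"
  assumes B: "B \<in> carrier_mat d d" and ut: "upper_triangular B" and ij: "j \<le> i" "i < d"
  shows "(B * B) $$ (i, j) = (if i = j then (B $$ (i, i))\<^sup>2 else 0)"
proof -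
  have "(B * B) $$ (i, j) = (\<Sum>t<d. B $$ (i, t) * B $$ (t, j))"
    using assms by (auto simp: scalar_prod_def lessThan_atLeast0)
  also have "\<dots> = (\<Sum>t<d. if t = i then (if i = j then (B $$ (i, i))\<^sup>2 else 0) else 0)"
  proof (intro sum.cong refl)
    fix t assume "t \<in> {..<d}"
    then show "B $$ (i, t) * B $$ (t, j) = (if t = i then (if i = j then (B $$ (i, i))\<^sup>2 else 0) else 0)"
      using B ij upper_triangularD[OF ut, of t i] upper_triangularD[OF ut, of j t]
      by (cases t i rule: linorder_cases) (auto simp: power2_eq_square)
  qed
  also have "\<dots> = (if i = j then (B $$ (i, i))\<^sup>2 else 0)" using ij by simp
  finally show ?thesis .
qed

text \<open>
  The complex Schur form \<open>B\<close> of \<open>H\<close> has the eigenvalues on its diagonal, and \<open>B\<^sup>2\<close> and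
  \<open>I - B\<^sup>2\<close> are again triangular, so trace and determinant can be read off.
\<close>
lemma symmetric_spectrum:
  assumes H: "symmetric_mat d H"
    and bound: "op_bound {..<d} (\<lambda>r s. H $$ (r, s)) c"
  obtains l :: "nat \<Rightarrow> real" where
    "\<And>i. i < d \<Longrightarrow> \<bar>l i\<bar> \<le> \<bar>c\<bar>"
    "mat_trace (H * H) = (\<Sum>i<d. (l i)\<^sup>2)"
    "Determinant.det (1\<^sub>m d - H * H) = (\<Prod>i<d. 1 - (l i)\<^sup>2)"
proof -
  let ?c = "complex_of_real"
  let ?H = "map_mat ?c H"
  have C: "H \<in> carrier_mat d d" using H by (simp add: symmetric_mat_def)
  then have HC: "?H \<in> carrier_mat d d" by simp
  obtain B where B: "B \<in> carrier_mat d d" and ut: "upper_triangular B" and sim: "similar_mat ?H B"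
    using char_poly_factorized[OF HC] schur_decomposition_exists[OF HC] by blast
  obtain P Q where "similar_mat_wit ?H B P Q" using sim by (auto simp: similar_mat_def)
  note w = similar_mat_witD2[OF HC this]
  define l where "l i = Re (B $$ (i, i))" for i
  have diag: "B $$ (i, i) = ?c (l i)" "\<bar>l i\<bar> \<le> \<bar>c\<bar>" if "i < d" for i
  proof -
    have "char_poly ?H = (\<Prod>a\<leftarrow>diag_mat B. [:- a, 1:])"
      using char_poly_similar[OF sim] char_poly_upper_triangular[OF B ut] by simp
    moreover have "B $$ (i, i) \<in> set (diag_mat B)" using B that by (auto simp: diag_mat_def)
    ultimately have "poly (char_poly ?H) (B $$ (i, i)) = 0"
      by (auto simp: poly_prod_list prod_list_zero_iff)
    then have "eigenvalue ?H (B $$ (i, i))" using eigenvalue_root_char_poly[OF HC] by simp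
    from symmetric_eigenvalue_real[OF H this bound]
    show "B $$ (i, i) = ?c (l i)" "\<bar>l i\<bar> \<le> \<bar>c\<bar>" by (simp_all add: l_def complex_eq_iff)
  qed
  have BB: "B * B \<in> carrier_mat d d" using B by simp
  have HH: "map_mat ?c (H * H) = P * (B * B) * Q"
  proof -
    have "map_mat ?c (H * H) = (P * B * Q) * (P * B * Q)"
      unfolding w(3)[symmetric] by (rule of_real_hom.mat_hom_mult[OF C C])
    also have "\<dots> = P * (B * ((Q * P) * (B * Q)))"
      using w(4-7) by (simp add: assoc_mult_mat[of _ d d _ d _ d])
    also have "\<dots> = P * (B * B) * Q"
      unfolding w(2) using w(4-7) by (simp add: assoc_mult_mat[of _ d d _ d _ d])
    finally show ?thesis .
  qed
  have "?c (mat_trace (H * H)) = (\<Sum>r<d. (map_mat ?c (H * H)) $$ (r, r))"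
    using C by (simp add: mat_trace_def)
  also have "\<dots> = (\<Sum>r<d. (Q * (P * (B * B))) $$ (r, r))"
    unfolding HH using w BB by (intro trace_mult_comm) auto
  also have "Q * (P * (B * B)) = (Q * P) * (B * B)"
    using w(4-7) BB by (intro assoc_mult_mat[symmetric]) auto
  also have "\<dots> = B * B" unfolding w(2) by (rule left_mult_one_mat[OF BB])
  also have "(\<Sum>r<d. (B * B) $$ (r, r)) = (\<Sum>r<d. ?c ((l r)\<^sup>2))"
    using upper_triangular_square[OF B ut] diag by (intro sum.cong refl) (simp del: index_mult_mat)
  finally have tr: "mat_trace (H * H) = (\<Sum>i<d. (l i)\<^sup>2)"
    by (simp only: of_real_sum[symmetric] of_real_eq_iff)
  have "map_mat ?c (1\<^sub>m d - H * H) = 1\<^sub>m d - map_mat ?c (H * H)"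
    using C by (intro eq_matI) auto
  also have "\<dots> = P * (1\<^sub>m d - B * B) * Q"
  proof -
    have "P * (1\<^sub>m d - B * B) * Q = (P * 1\<^sub>m d - P * (B * B)) * Q"
      using w(6) BB by (subst mult_minus_distrib_mat[of P d d]) auto
    also have "\<dots> = P * 1\<^sub>m d * Q - P * (B * B) * Q"
      using w(6,7) BB by (intro minus_mult_distrib_mat[of _ d d]) auto
    also have "P * 1\<^sub>m d * Q = 1\<^sub>m d" using w(1,6) by simp
    finally show ?thesis unfolding HH by (rule sym)
  qed
  finally have "similar_mat (map_mat ?c (1\<^sub>m d - H * H)) (1\<^sub>m d - B * B)"
    using w B C by (intro similar_matI[of _ _ P Q d]) auto
  then have "?c (Determinant.det (1\<^sub>m d - H * H)) = Determinant.det (1\<^sub>m d - B * B)"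
    by (simp add: det_similar flip: of_real_hom.hom_det)
  also have "upper_triangular (1\<^sub>m d - B * B)"
    using B upper_triangular_square[OF B ut] by (intro upper_triangularI) (simp del: index_mult_mat(1))
  then have "Determinant.det (1\<^sub>m d - B * B) = prod_list (diag_mat (1\<^sub>m d - B * B))"
    using B by (intro det_upper_triangular) auto
  also have "\<dots> = (\<Prod>i<d. (1\<^sub>m d - B * B) $$ (i, i))"
    using B by (simp add: prod_list_diag_prod lessThan_atLeast0)
  also have "\<dots> = (\<Prod>i<d. ?c (1 - (l i)\<^sup>2))"
    using B upper_triangular_square[OF B ut] diag by (intro prod.cong refl) (simp del: index_mult_mat(1))
  finally have "Determinant.det (1\<^sub>m d - H * H) = (\<Prod>i<d. 1 - (l i)\<^sup>2)"
    by (simp only: of_real_prod[symmetric] of_real_eq_iff)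
  with tr diag that show thesis by blast
qed

section \<open>The potential and the weight in terms of the trace\<close>

lemma exp_lower_bound_one_minus:
  fixes x :: real
  assumes "0 \<le> x" "x \<le> 1 / 4"
  shows "exp (- (4 / 3) * x) \<le> 1 - x"
proof -
  have "0 \<le> x * (1 / 3 - 4 / 3 * x)" using assms by (intro mult_nonneg_nonneg) auto
  then have "1 \<le> (1 - x) * (1 + 4 / 3 * x)" by (simp add: algebra_simps)
  also have "\<dots> \<le> (1 - x) * exp (4 / 3 * x)"
    using assms exp_ge_add_one_self[of "4 / 3 * x"] by (intro mult_left_mono) auto
  finally show ?thesis by (simp add: exp_minus field_simps)
qed

text \<open>
  The eigenvalues \<open>s\<close> of \<open>H\<^sup>2\<close> are at most \<open>1/4\<close>, and there \<open>1 - s \<ge> e\<^bsup>-4s/3\<^esup>\<close>, because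
  \<open>(1 - s) (1 + 4s/3) = 1 + s (1 - 4s) / 3 \<ge> 1\<close>.
\<close>
lemma det_one_minus_square_ge_exp:
  assumes H: "symmetric_mat d H" and le: "op_norm H \<le> 1 / 2"
  shows "exp (- (4 / 3) * mat_trace (H * H)) \<le> Determinant.det (1\<^sub>m d - H * H)"
proof -
  have "op_bound {..<d} (\<lambda>r s. H $$ (r, s)) (1 / 2)"
    using H le by (subst op_norm_le_iff[symmetric]) (auto simp: symmetric_mat_def)
  then obtain l :: "nat \<Rightarrow> real" where l: "\<And>i. i < d \<Longrightarrow> \<bar>l i\<bar> \<le> \<bar>1 / 2\<bar>"
    and tr: "mat_trace (H * H) = (\<Sum>i<d. (l i)\<^sup>2)"
    and det: "Determinant.det (1\<^sub>m d - H * H) = (\<Prod>i<d. 1 - (l i)\<^sup>2)"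
    using symmetric_spectrum[OF H] by metis
  have l2: "(l i)\<^sup>2 \<le> 1 / 4" if "i < d" for i
    using power_mono[OF l[OF that], of 2] by (simp add: power2_eq_square)
  have "exp (- (4 / 3) * mat_trace (H * H)) = (\<Prod>i<d. exp (- (4 / 3) * (l i)\<^sup>2))"
    unfolding tr by (simp add: sum_distrib_left exp_sum sum_negf[symmetric])
  also have "\<dots> \<le> (\<Prod>i<d. 1 - (l i)\<^sup>2)"
    using l2 by (intro prod_mono conjI exp_lower_bound_one_minus) auto
  finally show ?thesis unfolding det .
qed

lemma det_one_minus_square_bounds:
  assumes H: "symmetric_mat d H" and less: "op_norm H < 1"
  shows "1 - mat_trace (H * H) \<le> Determinant.det (1\<^sub>m d - H * H)"
    and "Determinant.det (1\<^sub>m d - H * H) \<le> 1"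
    and "0 < Determinant.det (1\<^sub>m d - H * H)"
proof -
  define c where "c = max 0 (op_norm H)"
  have c: "0 \<le> c" "c < 1" using less by (auto simp: c_def)
  have "op_bound {..<d} (\<lambda>r s. H $$ (r, s)) c"
    using H by (subst op_norm_le_iff[symmetric]) (auto simp: symmetric_mat_def c_def)
  then obtain l :: "nat \<Rightarrow> real" where l: "\<And>i. i < d \<Longrightarrow> \<bar>l i\<bar> \<le> \<bar>c\<bar>"
    and tr: "mat_trace (H * H) = (\<Sum>i<d. (l i)\<^sup>2)"
    and det: "Determinant.det (1\<^sub>m d - H * H) = (\<Prod>i<d. 1 - (l i)\<^sup>2)"
    using symmetric_spectrum[OF H] by metis
  have l2: "(l i)\<^sup>2 < 1" if "i < d" for i
    using l[OF that] c by (simp add: abs_square_less_1)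
  show "1 - mat_trace (H * H) \<le> Determinant.det (1\<^sub>m d - H * H)"
    unfolding tr det using l2 by (intro Weierstrass_prod_ineq) (auto intro: less_imp_le)
  show "Determinant.det (1\<^sub>m d - H * H) \<le> 1"
    unfolding det using l2 by (intro prod_le_1) (auto intro: less_imp_le)
  show "0 < Determinant.det (1\<^sub>m d - H * H)"
    unfolding det using l2 by (intro prod_pos) auto
qed

text \<open>
  The lower bound survives the truncation of \<open>W\<close> at norm 1: if \<open>\<parallel>H\<parallel> \<ge> 1\<close>, then the Frobenius norm is
  at least 1 as well and \<open>1 - tr(H\<^sup>2) \<le> 0\<close>.
\<close>
lemma W_bounds:
  assumes H: "symmetric_mat d H"
  shows "1 - mat_trace (H * H) \<le> W 1 H" "0 \<le> W 1 H" "W 1 H \<le> 1"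
proof -
  have C: "H \<in> carrier_mat d d" using H by (simp add: symmetric_mat_def)
  have "1 - mat_trace (H * H) \<le> W 1 H \<and> 0 \<le> W 1 H \<and> W 1 H \<le> 1"
  proof (cases "op_norm H < 1")
    case True
    then show ?thesis using det_one_minus_square_bounds[OF H True] C by (simp add: W_def)
  next
    case False
    have "op_norm H \<le> sqrt (mat_trace (H * H))"
      unfolding mat_trace_square[OF H] op_norm_le_iff[OF C real_sqrt_ge_zero[OF sum_nonneg[OF sum_nonneg[OF zero_le_power2]]]]
      by (rule op_bound_frobenius)
    with False have "1 \<le> sqrt (mat_trace (H * H))" by linarith
    then have "1 \<le> mat_trace (H * H)" by simp
    then show ?thesis using False by (simp add: W_def)
  qed
  then show "1 - mat_trace (H * H) \<le> W 1 H" "0 \<le> W 1 H" "W 1 H \<le> 1" by auto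
qed

lemma W_eq_powr:
  assumes "symmetric_mat d H"
  shows "W \<beta> H = W 1 H powr \<beta>"
proof -
  have "H \<in> carrier_mat d d" using assms by (simp add: symmetric_mat_def)
  then show ?thesis
    using det_one_minus_square_bounds[OF assms] by (auto simp: W_def)
qed

lemma Phi_le:
  assumes H: "symmetric_mat d H" and le: "op_norm H \<le> 1 / 2"
  shows "Phi H \<le> ereal (4 / 3 * mat_trace (H * H))"
proof -
  have "H \<in> carrier_mat d d" using H by (simp add: symmetric_mat_def)
  moreover have "- (4 / 3) * mat_trace (H * H) \<le> ln (Determinant.det (1\<^sub>m d - H * H))"
    using det_one_minus_square_ge_exp[OF H le] det_one_minus_square_bounds(3)[OF H] le
    by (subst ln_ge_iff) auto
  ultimately show ?thesis using le by (simp add: Phi_def)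
qed

lemma W_ge_exp:
  assumes H: "symmetric_mat d H" and le: "op_norm H \<le> 1 / 2" and \<beta>: "\<beta> > 0"
  shows "exp (- \<beta> * (4 / 3 * mat_trace (H * H))) \<le> W \<beta> H"
proof -
  have "H \<in> carrier_mat d d" using H by (simp add: symmetric_mat_def)
  moreover have "exp (- (4 / 3) * mat_trace (H * H)) powr \<beta> \<le> Determinant.det (1\<^sub>m d - H * H) powr \<beta>"
    using det_one_minus_square_ge_exp[OF H le] \<beta> by (intro powr_mono2) auto
  ultimately show ?thesis using le by (simp add: W_def powr_def mult_ac)
qed

section \<open>Coloring a direct sum\<close>

lemma op_bound_reindex:
  assumes "bij_betw e I I'"
  shows "op_bound I (\<lambda>r s. M (e r) (e s)) c \<longleftrightarrow> op_bound I' M c"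
proof
  assume *: "op_bound I (\<lambda>r s. M (e r) (e s)) c"
  show "op_bound I' M c"
    unfolding op_bound_def
  proof
    fix f :: "_ \<Rightarrow> real"
    show "(\<Sum>r\<in>I'. (\<Sum>s\<in>I'. M r s * f s)\<^sup>2) \<le> c\<^sup>2 * (\<Sum>s\<in>I'. (f s)\<^sup>2)"
      using op_boundD[OF *, of "f \<circ> e"]
      by (simp add: sum.reindex_bij_betw[OF assms, of "\<lambda>s. M r s * f s" for r]
          sum.reindex_bij_betw[OF assms, of "\<lambda>s. (f s)\<^sup>2"]
          sum.reindex_bij_betw[OF assms, of "\<lambda>r. (\<Sum>s\<in>I'. M r s * f s)\<^sup>2"])
  qed
next
  assume *: "op_bound I' M c"
  show "op_bound I (\<lambda>r s. M (e r) (e s)) c"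
    unfolding op_bound_def
  proof
    fix f :: "_ \<Rightarrow> real"
    define g where "g = f \<circ> the_inv_into I e"
    have f: "f s = g (e s)" if "s \<in> I" for s
      using that assms by (simp add: g_def the_inv_into_f_f bij_betw_def)
    have "(\<Sum>r\<in>I. (\<Sum>s\<in>I. M (e r) (e s) * g (e s))\<^sup>2) \<le> c\<^sup>2 * (\<Sum>s\<in>I. (g (e s))\<^sup>2)"
      using op_boundD[OF *, of g]
      by (simp add: sum.reindex_bij_betw[OF assms, of "\<lambda>s. M r s * g s" for r]
          sum.reindex_bij_betw[OF assms, of "\<lambda>s. (g s)\<^sup>2"]
          sum.reindex_bij_betw[OF assms, of "\<lambda>r. (\<Sum>s\<in>I'. M r s * g s)\<^sup>2"])
    then show "(\<Sum>r\<in>I. (\<Sum>s\<in>I. M (e r) (e s) * f s)\<^sup>2) \<le> c\<^sup>2 * (\<Sum>s\<in>I. (f s)\<^sup>2)"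
      by (simp add: f cong: sum.cong)
  qed
qed

definition direct_sum :: "('k \<Rightarrow> 'i \<Rightarrow> 'i \<Rightarrow> real) \<Rightarrow> 'k \<times> 'i \<Rightarrow> 'k \<times> 'i \<Rightarrow> real" where
  "direct_sum M p q = (if fst p = fst q then M (fst p) (snd p) (snd q) else 0)"

lemma sum_direct_sum:
  assumes "finite B" "\<And>k. k \<in> B \<Longrightarrow> finite (I k)" "k \<in> B"
  shows "(\<Sum>q\<in>Sigma B I. direct_sum M (k, r) q * f q) = (\<Sum>s\<in>I k. M k r s * f (k, s))"
proof -
  have "(\<Sum>q\<in>Sigma B I. direct_sum M (k, r) q * f q)
      = (\<Sum>l\<in>B. \<Sum>s\<in>I l. direct_sum M (k, r) (l, s) * f (l, s))"
    using assms by (subst sum.Sigma) (auto simp: split_def)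
  also have "\<dots> = (\<Sum>l\<in>B. if l = k then (\<Sum>s\<in>I l. M k r s * f (l, s)) else 0)"
    by (intro sum.cong refl) (auto simp: direct_sum_def)
  also have "\<dots> = (\<Sum>s\<in>I k. M k r s * f (k, s))" using assms by simp
  finally show ?thesis .
qed

text \<open>
  The squared norms of the blocks of a vector add up; for the converse, extend a vector on one block
  by zero.
\<close>
lemma op_bound_direct_sum:
  fixes I :: "'k \<Rightarrow> 'i set"
  assumes fin: "finite B" "\<And>k. k \<in> B \<Longrightarrow> finite (I k)"
  shows "op_bound (Sigma B I) (direct_sum M) c \<longleftrightarrow> (\<forall>k\<in>B. op_bound (I k) (M k) c)"
proof -
  have L: "(\<Sum>p\<in>Sigma B I. (\<Sum>q\<in>Sigma B I. direct_sum M p q * f q)\<^sup>2)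
      = (\<Sum>k\<in>B. \<Sum>r\<in>I k. (\<Sum>s\<in>I k. M k r s * f (k, s))\<^sup>2)" for f
  proof -
    have "(\<Sum>p\<in>Sigma B I. (\<Sum>q\<in>Sigma B I. direct_sum M p q * f q)\<^sup>2)
        = (\<Sum>k\<in>B. \<Sum>r\<in>I k. (\<Sum>q\<in>Sigma B I. direct_sum M (k, r) q * f q)\<^sup>2)"
      using fin by (subst sum.Sigma) (auto simp: split_def)
    then show ?thesis by (simp add: sum_direct_sum[OF fin])
  qed
  have R: "(\<Sum>p\<in>Sigma B I. (f p)\<^sup>2) = (\<Sum>k\<in>B. \<Sum>s\<in>I k. (f (k, s))\<^sup>2)" for f :: "_ \<Rightarrow> real"
    using fin by (subst sum.Sigma) (auto simp: split_def)
  show ?thesis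
  proof
    assume *: "\<forall>k\<in>B. op_bound (I k) (M k) c"
    show "op_bound (Sigma B I) (direct_sum M) c"
      unfolding op_bound_def L R sum_distrib_left[of _ _ B]
      using * by (intro allI sum_mono op_boundD) auto
  next
    assume *: "op_bound (Sigma B I) (direct_sum M) c"
    show "\<forall>k\<in>B. op_bound (I k) (M k) c"
    proof (intro ballI, unfold op_bound_def, intro allI)
      fix k and f :: "'i \<Rightarrow> real" assume k: "k \<in> B"
      define g :: "_ \<Rightarrow> real" where "g = (\<lambda>(l, s). if l = k then f s else 0)"
      have "(\<Sum>l\<in>B. \<Sum>r\<in>I l. (\<Sum>s\<in>I l. M l r s * g (l, s))\<^sup>2)
          = (\<Sum>l\<in>B. if l = k then \<Sum>r\<in>I k. (\<Sum>s\<in>I k. M k r s * f s)\<^sup>2 else 0)"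
        by (intro sum.cong refl) (auto simp: g_def)
      moreover have "(\<Sum>l\<in>B. \<Sum>s\<in>I l. (g (l, s))\<^sup>2) = (\<Sum>l\<in>B. if l = k then \<Sum>s\<in>I k. (f s)\<^sup>2 else 0)"
        by (intro sum.cong refl) (auto simp: g_def)
      ultimately show "(\<Sum>r\<in>I k. (\<Sum>s\<in>I k. M k r s * f s)\<^sup>2) \<le> c\<^sup>2 * (\<Sum>s\<in>I k. (f s)\<^sup>2)"
        using op_boundD[OF *, of g] k fin by (simp add: L R)
    qed
  qed
qed

text \<open>
  The coloring property transported along enumerations of the matrix index set \<open>X\<close> and of the
  family index set \<open>J\<close>.
\<close>
lemma coloring_indexed:
  assumes E: "coloring_property a b" "a \<ge> 0"
    and fin: "finite X" "finite J"
    and sym: "\<And>j r s. j \<in> J \<Longrightarrow> r \<in> X \<Longrightarrow> s \<in> X \<Longrightarrow> M j r s = M j s r"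
    and sq: "op_bound X (\<lambda>r s. \<Sum>j\<in>J. \<Sum>t\<in>X. M j r t * M j t s) a"
    and tr: "\<And>j. j \<in> J \<Longrightarrow> (\<Sum>r\<in>X. \<Sum>s\<in>X. (M j r s)\<^sup>2) \<le> b"
  shows "\<exists>x \<in> J \<rightarrow>\<^sub>E {-1, 1}. op_bound X (\<lambda>r s. \<Sum>j\<in>J. x j * M j r s) 1"
proof -
  define D N where "D = card X" and "N = card J"
  obtain e u where e: "bij_betw e {..<D} X" and u: "bij_betw u {..<N} J"
    using ex_bij_betw_nat_finite[OF fin(1)] ex_bij_betw_nat_finite[OF fin(2)]
    by (auto simp: D_def N_def lessThan_atLeast0)
  have eX: "e r \<in> X" if "r < D" for r using that e by (auto simp: bij_betw_def)
  have uJ: "u i \<in> J" if "i < N" for i using that u by (auto simp: bij_betw_def)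
  define C where "C i = mat D D (\<lambda>(r, s). M (u i) (e r) (e s))" for i
  have CC [simp]: "C i \<in> carrier_mat D D" for i by (simp add: C_def)
  have C: "C i $$ (r, s) = M (u i) (e r) (e s)" if "r < D" "s < D" for i r s
    using that by (simp add: C_def)
  have symC: "symmetric_mat D (C i)" if "i < N" for i
    using sym[OF uJ[OF that] eX eX] by (auto simp: symmetric_mat_def C_def intro!: eq_matI)
  have entry: "mat_sum D N (\<lambda>i. C i * C i) $$ (r, s)
      = (\<Sum>j\<in>J. \<Sum>t\<in>X. M j (e r) t * M j t (e s))" if "r < D" "s < D" for r s
  proof -
    have "mat_sum D N (\<lambda>i. C i * C i) $$ (r, s) = (\<Sum>i<N. (C i * C i) $$ (r, s))"
      using that by (simp add: mat_sum_def)
    also have "\<dots> = (\<Sum>i<N. \<Sum>t<D. M (u i) (e r) (e t) * M (u i) (e t) (e s))"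
      using that by (intro sum.cong refl) (simp add: mat_mult_entry[OF CC CC] C del: index_mult_mat)
    finally show ?thesis
      by (simp add: sum.reindex_bij_betw[OF e, of "\<lambda>t. M (u i) (e r) t * M (u i) t (e s)" for i]
          sum.reindex_bij_betw[OF u, of "\<lambda>j. \<Sum>t\<in>X. M j (e r) t * M j t (e s)"])
  qed
  have 1: "op_norm (mat_sum D N (\<lambda>i. C i * C i)) \<le> a"
  proof -
    have "op_bound {..<D} (\<lambda>r s. mat_sum D N (\<lambda>i. C i * C i) $$ (r, s)) a"
      using sq unfolding op_bound_reindex[OF e, symmetric]
      by (rule iffD2[OF op_bound_cong, rotated]) (simp add: entry)
    then show ?thesis using E(2) by (subst op_norm_le_iff[of _ D]) simp_all
  qed
  have 2: "mat_trace (C i * C i) \<le> b" if "i < N" for i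
  proof -
    have "mat_trace (C i * C i) = (\<Sum>r<D. \<Sum>s<D. (M (u i) (e r) (e s))\<^sup>2)"
      by (simp add: mat_trace_square[OF symC[OF that]] C)
    also have "\<dots> \<le> b"
      using tr[OF uJ[OF that]]
      by (simp add: sum.reindex_bij_betw[OF e, of "\<lambda>s. (M (u i) r s)\<^sup>2" for r]
          sum.reindex_bij_betw[OF e, of "\<lambda>r. \<Sum>s\<in>X. (M (u i) r s)\<^sup>2"])
    finally show ?thesis .
  qed
  obtain y where y: "y \<in> sign_cube N" and le: "op_norm (signed_sum D N C y) \<le> 1"
    using E(1) symC 1 2 unfolding coloring_property_def by blast
  define x where "x = restrict (y \<circ> the_inv_into {..<N} u) J"
  have xu: "x (u i) = y i" if "i < N" for i
    using that u uJ[OF that] by (simp add: x_def the_inv_into_f_f bij_betw_def)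
  have "x j \<in> {-1, 1}" if "j \<in> J" for j
  proof -
    obtain i where "i < N" "j = u i" using u \<open>j \<in> J\<close> by (auto simp: bij_betw_def)
    then show ?thesis using xu y by (auto simp: sign_cube_def)
  qed
  then have x: "x \<in> J \<rightarrow>\<^sub>E {-1, 1}" by (auto simp: x_def)
  have "signed_sum D N C y $$ (r, s) = (\<Sum>j\<in>J. x j * M j (e r) (e s))" if "r < D" "s < D" for r s
  proof -
    have "signed_sum D N C y $$ (r, s) = (\<Sum>i<N. x (u i) * M (u i) (e r) (e s))"
      using that by (simp add: signed_sum_entry C xu)
    then show ?thesis
      by (simp add: sum.reindex_bij_betw[OF u, of "\<lambda>j. x j * M j (e r) (e s)"])
  qed
  moreover have "op_bound {..<D} (\<lambda>r s. signed_sum D N C y $$ (r, s)) 1"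
    using le by (subst (asm) op_norm_le_iff[of _ D]) simp_all
  ultimately have "op_bound {..<D} (\<lambda>r s. \<Sum>j\<in>J. x j * M j (e r) (e s)) 1"
    by (subst op_bound_cong[of _ _ "\<lambda>r s. signed_sum D N C y $$ (r, s)"]) simp_all
  then have "op_bound X (\<lambda>r s. \<Sum>j\<in>J. x j * M j r s) 1"
    using op_bound_reindex[OF e, of "\<lambda>r s. \<Sum>j\<in>J. x j * M j r s" 1] by simp
  with x show ?thesis by blast
qed

text \<open>
  Coloring several families at once by the same signs: each block \<open>k\<close> must satisfy the norm condition
  separately, while the trace condition is on the sum over all blocks. This asymmetry is what the
  amplification below exploits.
\<close>
lemma coloring_blocks:
  assumes E: "coloring_property a b" "a \<ge> 0"
    and fin: "finite B" "\<And>k. k \<in> B \<Longrightarrow> finite (I k)" "finite J"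
    and sym: "\<And>j k r s. j \<in> J \<Longrightarrow> k \<in> B \<Longrightarrow> r \<in> I k \<Longrightarrow> s \<in> I k \<Longrightarrow> M j k r s = M j k s r"
    and sq: "\<And>k. k \<in> B \<Longrightarrow> op_bound (I k) (\<lambda>r s. \<Sum>j\<in>J. \<Sum>t\<in>I k. M j k r t * M j k t s) a"
    and tr: "\<And>j. j \<in> J \<Longrightarrow> (\<Sum>k\<in>B. \<Sum>r\<in>I k. \<Sum>s\<in>I k. (M j k r s)\<^sup>2) \<le> b"
  shows "\<exists>x \<in> J \<rightarrow>\<^sub>E {-1, 1}. \<forall>k\<in>B. op_bound (I k) (\<lambda>r s. \<Sum>j\<in>J. x j * M j k r s) 1"
proof -
  let ?X = "Sigma B I"
  have "\<exists>x \<in> J \<rightarrow>\<^sub>E {-1, 1}. op_bound ?X (\<lambda>p q. \<Sum>j\<in>J. x j * direct_sum (M j) p q) 1"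
  proof (rule coloring_indexed[OF E])
    show "finite ?X" "finite J" using fin by auto
    show "direct_sum (M j) p q = direct_sum (M j) q p" if "j \<in> J" "p \<in> ?X" "q \<in> ?X" for j p q
      using that sym by (auto simp: direct_sum_def)
    have "(\<Sum>j\<in>J. \<Sum>t\<in>?X. direct_sum (M j) p t * direct_sum (M j) t q)
        = direct_sum (\<lambda>k r s. \<Sum>j\<in>J. \<Sum>t\<in>I k. M j k r t * M j k t s) p q"
      if "p \<in> ?X" "q \<in> ?X" for p q
    proof -
      obtain k r l s where pq: "p = (k, r)" "q = (l, s)" "k \<in> B" using \<open>p \<in> ?X\<close> by (cases q) auto
      show ?thesis
        unfolding pq by (subst sum_direct_sum[OF fin(1,2) pq(3)]) (auto simp: direct_sum_def)
    qed
    then show "op_bound ?X (\<lambda>p q. \<Sum>j\<in>J. \<Sum>t\<in>?X. direct_sum (M j) p t * direct_sum (M j) t q) a"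
      by (rule iffD2[OF op_bound_cong]) (use sq op_bound_direct_sum[OF fin(1,2)] in auto)
    show "(\<Sum>p\<in>?X. \<Sum>q\<in>?X. (direct_sum (M j) p q)\<^sup>2) \<le> b" if "j \<in> J" for j
    proof -
      have "(\<Sum>p\<in>?X. \<Sum>q\<in>?X. (direct_sum (M j) p q)\<^sup>2)
          = (\<Sum>k\<in>B. \<Sum>r\<in>I k. \<Sum>q\<in>?X. direct_sum (M j) (k, r) q * direct_sum (M j) (k, r) q)"
        using fin by (subst sum.Sigma) (auto simp: split_def power2_eq_square)
      also have "\<dots> = (\<Sum>k\<in>B. \<Sum>r\<in>I k. \<Sum>s\<in>I k. (M j k r s)\<^sup>2)"
        by (intro sum.cong refl, subst sum_direct_sum[OF fin(1,2)])
           (auto simp: direct_sum_def power2_eq_square)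
      finally show ?thesis using tr[OF that] by simp
    qed
  qed
  then obtain x where x: "x \<in> J \<rightarrow>\<^sub>E {-1, 1}"
    and "op_bound ?X (\<lambda>p q. \<Sum>j\<in>J. x j * direct_sum (M j) p q) 1" by blast
  moreover have "(\<lambda>p q. \<Sum>j\<in>J. x j * direct_sum (M j) p q)
      = direct_sum (\<lambda>k r s. \<Sum>j\<in>J. x j * M j k r s)"
    by (auto simp: direct_sum_def fun_eq_iff)
  ultimately show ?thesis using op_bound_direct_sum[OF fin(1,2)] by auto
qed

section \<open>From one coloring to exponentially many\<close>

lemma card_residue_class_le:
  fixes m R l :: nat
  assumes "m > 0"
  shows "real (card {k. k < R \<and> k mod m = l}) \<le> R / m + 1"
proof -
  have "card {k. k < R \<and> k mod m = l} \<le> card {..R div m}"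
  proof (rule card_inj_on_le[of "\<lambda>k. k div m"])
    show "inj_on (\<lambda>k. k div m) {k. k < R \<and> k mod m = l}"
      by (intro inj_onI) (metis (mono_tags, lifting) div_mult_mod_eq mem_Collect_eq)
    show "(\<lambda>k. k div m) ` {k. k < R \<and> k mod m = l} \<subseteq> {..R div m}"
      by (auto simp: div_le_mono)
  qed simp
  then show ?thesis using of_nat_div_le_of_nat[of R m, where ?'a = real] by simp
qed

text \<open>
  Copy \<open>k\<close> of the family is the translate of \<open>C\<close> by the sign vector \<open>z k\<close>, and it uses the sign
  \<open>y (i, k mod m i)\<close> for index \<open>i\<close>. A given sign then occurs in at most \<open>R / m i + 1\<close> copies, and its
  trace is at most \<open>R t\<^sub>i / m\<^sub>i + t\<^sub>i \<le> b/2 + b/2\<close>. The norm condition holds in each copy because the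
  factors \<open>z k i\<close> square to 1.
\<close>
lemma shared_coloring:
  fixes C :: "nat \<Rightarrow> 'k \<Rightarrow> 'i \<Rightarrow> 'i \<Rightarrow> real" and z :: "nat \<Rightarrow> nat \<Rightarrow> real" and R :: nat
  assumes E: "coloring_property a b" "a \<ge> 0" and b: "b > 0"
    and fin: "finite B" "\<And>k. k \<in> B \<Longrightarrow> finite (I k)"
    and sym: "\<And>i k r s. i < n \<Longrightarrow> k \<in> B \<Longrightarrow> r \<in> I k \<Longrightarrow> s \<in> I k \<Longrightarrow> C i k r s = C i k s r"
    and sq: "\<And>k. k \<in> B \<Longrightarrow> op_bound (I k) (\<lambda>r s. \<Sum>i<n. \<Sum>t\<in>I k. C i k r t * C i k t s) a"
    and t: "\<And>i. i < n \<Longrightarrow> t i = (\<Sum>k\<in>B. \<Sum>r\<in>I k. \<Sum>s\<in>I k. (C i k r s)\<^sup>2)"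
    and tr: "\<And>i. i < n \<Longrightarrow> t i \<le> b / 2"
    and m: "\<And>i. i < n \<Longrightarrow> m i > 0" "\<And>i. i < n \<Longrightarrow> 2 * real R * t i / b \<le> real (m i)"
    and z: "\<And>k. k < R \<Longrightarrow> z k \<in> sign_cube n"
  shows "\<exists>y \<in> Sigma {..<n} (\<lambda>i. {..<m i}) \<rightarrow>\<^sub>E {-1, 1}. \<forall>k<R. \<forall>c\<in>B.
      op_bound (I c) (\<lambda>r s. \<Sum>i<n. y (i, k mod m i) * z k i * C i c r s) 1"
proof -
  let ?J = "Sigma {..<n} (\<lambda>i. {..<m i})" and ?B = "{..<R} \<times> B"
  let ?I = "\<lambda>c. I (snd c)"
  define M where "M j c r s =
    (if fst c mod m (fst j) = snd j then z (fst c) (fst j) * C (fst j) (snd c) r s else 0)"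
    for j :: "nat \<times> nat" and c :: "nat \<times> 'k" and r s
  have sumJ: "(\<Sum>j\<in>?J. if k mod m (fst j) = snd j then F j else 0) = (\<Sum>i<n. F (i, k mod m i))"
    for F :: "nat \<times> nat \<Rightarrow> real" and k
  proof -
    have "(\<Sum>j\<in>?J. if k mod m (fst j) = snd j then F j else 0)
        = (\<Sum>i<n. \<Sum>l<m i. if k mod m i = l then F (i, l) else 0)"
      by (subst sum.Sigma) (auto simp: split_def intro!: sum.cong)
    also have "\<dots> = (\<Sum>i<n. F (i, k mod m i))" using m by (intro sum.cong refl) auto
    finally show ?thesis .
  qed
  have "\<exists>y \<in> ?J \<rightarrow>\<^sub>E {-1, 1}. \<forall>c\<in>?B. op_bound (?I c) (\<lambda>r s. \<Sum>j\<in>?J. y j * M j c r s) 1"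
  proof (rule coloring_blocks[OF E])
    show "finite ?B" "\<And>c. c \<in> ?B \<Longrightarrow> finite (?I c)" "finite ?J" using fin by auto
    show "M j c r s = M j c s r" if "j \<in> ?J" "c \<in> ?B" "r \<in> ?I c" "s \<in> ?I c" for j c r s
      using that sym by (auto simp: M_def)
    show "op_bound (?I c) (\<lambda>r s. \<Sum>j\<in>?J. \<Sum>u\<in>?I c. M j c r u * M j c u s) a" if c: "c \<in> ?B" for c
    proof -
      obtain k \<beta> where kb: "c = (k, \<beta>)" "k < R" "\<beta> \<in> B" using c by auto
      have "(\<Sum>j\<in>?J. \<Sum>u\<in>?I c. M j c r u * M j c u s) = (\<Sum>i<n. \<Sum>u\<in>I \<beta>. C i \<beta> r u * C i \<beta> u s)" for r s
      proof -
        have "(\<Sum>j\<in>?J. \<Sum>u\<in>?I c. M j c r u * M j c u s) = (\<Sum>j\<in>?J. if k mod m (fst j) = snd j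
            then \<Sum>u\<in>I \<beta>. (z k (fst j) * z k (fst j)) * (C (fst j) \<beta> r u * C (fst j) \<beta> u s) else 0)"
          by (intro sum.cong refl) (auto simp: M_def kb mult_ac)
        also have "\<dots> = (\<Sum>i<n. \<Sum>u\<in>I \<beta>. (z k i * z k i) * (C i \<beta> r u * C i \<beta> u s))"
          by (subst sumJ) simp
        also have "\<dots> = (\<Sum>i<n. \<Sum>u\<in>I \<beta>. C i \<beta> r u * C i \<beta> u s)"
          using z[OF kb(2)] by (intro sum.cong refl) (simp add: sign_square_one[of "z k" "{..<n}"] sign_cube_def)
        finally show ?thesis .
      qed
      then show ?thesis using sq kb by simp
    qed
    show "(\<Sum>c\<in>?B. \<Sum>r\<in>?I c. \<Sum>s\<in>?I c. (M j c r s)\<^sup>2) \<le> b" if j: "j \<in> ?J" for j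
    proof -
      obtain i l where il: "j = (i, l)" "i < n" "l < m i" using j by auto
      have z2: "(z k i)\<^sup>2 = 1" if "k < R" for k
        using z[OF that] il sign_square_one[of "z k" "{..<n}" i] by (simp add: power2_eq_square sign_cube_def)
      have "(\<Sum>c\<in>?B. \<Sum>r\<in>?I c. \<Sum>s\<in>?I c. (M j c r s)\<^sup>2)
          = (\<Sum>k<R. \<Sum>\<beta>\<in>B. \<Sum>r\<in>I \<beta>. \<Sum>s\<in>I \<beta>. (M j (k, \<beta>) r s)\<^sup>2)"
        using fin by (subst sum.cartesian_product) (auto simp: split_def)
      also have "\<dots> = (\<Sum>k<R. if k mod m i = l then t i else 0)"
      proof (intro sum.cong refl)
        fix k assume "k \<in> {..<R}"
        then show "(\<Sum>\<beta>\<in>B. \<Sum>r\<in>I \<beta>. \<Sum>s\<in>I \<beta>. (M j (k, \<beta>) r s)\<^sup>2) = (if k mod m i = l then t i else 0)"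
          using z2[of k] by (simp add: M_def il t power_mult_distrib)
      qed
      also have "\<dots> = real (card {k. k < R \<and> k mod m i = l}) * t i"
        by (simp add: sum.If_cases Collect_conj_eq lessThan_def)
      also have "\<dots> \<le> (R / m i + 1) * t i"
        using card_residue_class_le[OF m(1)[OF il(2)]] il(2)
        by (intro mult_right_mono) (auto simp: t intro!: sum_nonneg)
      also have "\<dots> = R * t i / m i + t i" by (simp add: algebra_simps)
      also have "\<dots> \<le> b / 2 + b / 2"
        using m[OF il(2)] tr[OF il(2)] b by (intro add_mono) (auto simp: field_simps)
      finally show ?thesis by simp
    qed
  qed
  then obtain y where y: "y \<in> ?J \<rightarrow>\<^sub>E {-1, 1}"
    and bd: "\<And>k c. k < R \<Longrightarrow> c \<in> B \<Longrightarrow> op_bound (I c) (\<lambda>r s. \<Sum>j\<in>?J. y j * M j (k, c) r s) 1"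
    by auto
  have "(\<Sum>j\<in>?J. y j * M j (k, c) r s) = (\<Sum>i<n. y (i, k mod m i) * z k i * C i c r s)" for k c r s
  proof -
    have "(\<Sum>j\<in>?J. y j * M j (k, c) r s)
        = (\<Sum>j\<in>?J. if k mod m (fst j) = snd j then y j * z k (fst j) * C (fst j) c r s else 0)"
      by (intro sum.cong refl) (auto simp: M_def)
    then show ?thesis by (simp only: sumJ fst_conv)
  qed
  with y bd show ?thesis by auto
qed

text \<open>
  Counting the translates \<open>z\<close>: by \<open>shared_coloring\<close> every \<open>R\<close>-tuple of sign vectors is turned into an
  \<open>R\<close>-tuple of good vectors by some pattern \<open>y\<close>, and each pattern acts as an involution, so the
  \<open>R\<close>-tuples of the cube are covered by \<open>2\<^bsup>\<Sum>m\<^sub>i\<^esup>\<close> images of the good \<open>R\<close>-tuples. With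
  \<open>m\<^sub>i \<le> 2 R t\<^sub>i / b + 1\<close> the error from rounding is \<open>n / R\<close> in the exponent and disappears in the
  limit.
\<close>
theorem many_colorings:
  fixes C :: "nat \<Rightarrow> 'k \<Rightarrow> 'i \<Rightarrow> 'i \<Rightarrow> real"
  assumes E: "coloring_property a b" "a \<ge> 0" and b: "b > 0"
    and fin: "finite B" "\<And>k. k \<in> B \<Longrightarrow> finite (I k)"
    and sym: "\<And>i k r s. i < n \<Longrightarrow> k \<in> B \<Longrightarrow> r \<in> I k \<Longrightarrow> s \<in> I k \<Longrightarrow> C i k r s = C i k s r"
    and sq: "\<And>k. k \<in> B \<Longrightarrow> op_bound (I k) (\<lambda>r s. \<Sum>i<n. \<Sum>t\<in>I k. C i k r t * C i k t s) a"
    and t: "\<And>i. i < n \<Longrightarrow> t i = (\<Sum>k\<in>B. \<Sum>r\<in>I k. \<Sum>s\<in>I k. (C i k r s)\<^sup>2)"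
    and tr: "\<And>i. i < n \<Longrightarrow> t i \<le> b / 2"
  defines "good \<equiv> {x \<in> sign_cube n. \<forall>k\<in>B. op_bound (I k) (\<lambda>r s. \<Sum>i<n. x i * C i k r s) 1}"
  shows "exp (- (2 * ln 2 / b) * (\<Sum>i<n. t i)) \<le> card good / 2 ^ n"
proof -
  define T where "T = (\<Sum>i<n. t i)"
  define p :: real where "p = card good / 2 ^ n"
  have t0: "t i \<ge> 0" if "i < n" for i using that by (auto simp: t intro!: sum_nonneg)
  have good: "finite good" "good \<subseteq> sign_cube n" by (auto simp: good_def)
  have key: "p > 0 \<and> - ln p \<le> (2 * T / b + n / R) * ln 2" if R: "R > 0" for R :: nat
  proof -
    \<comment> \<open>large enough for the trace condition, and positive also when \<open>t i = 0\<close>\<close>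
    define m where "m i = nat \<lfloor>2 * real R * t i / b\<rfloor> + 1" for i
    have m: "2 * real R * t i / b \<le> m i" "m i \<le> 2 * real R * t i / b + 1" if "i < n" for i
      using t0[OF that] b unfolding m_def by auto linarith+
    let ?J = "Sigma {..<n} (\<lambda>i. {..<m i})" and ?Y = "Sigma {..<n} (\<lambda>i. {..<m i}) \<rightarrow>\<^sub>E {-1, 1::real}"
    \<comment> \<open>\<open>\<Theta> y\<close> multiplies copy \<open>k\<close> by the pattern that \<open>y\<close> prescribes for it; it is an involution on tuples of sign vectors.\<close>
    define \<Theta> where "\<Theta> y z = (\<lambda>k\<in>{..<R}. \<lambda>i\<in>{..<n}. y (i, k mod m i) * z k i)"
      for y :: "nat \<times> nat \<Rightarrow> real" and z :: "nat \<Rightarrow> nat \<Rightarrow> real"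
    have m0: "m i > 0" for i by (simp add: m_def)
    have "({..<R} \<rightarrow>\<^sub>E sign_cube n) \<subseteq> (\<Union>y\<in>?Y. \<Theta> y ` ({..<R} \<rightarrow>\<^sub>E good))"
    proof
      fix z assume z: "z \<in> {..<R} \<rightarrow>\<^sub>E sign_cube n"
      then have zk: "z k \<in> sign_cube n" if "k < R" for k using that by auto
      have "\<exists>y\<in>?Y. \<forall>k<R. \<forall>c\<in>B. op_bound (I c) (\<lambda>r s. \<Sum>i<n. y (i, k mod m i) * z k i * C i c r s) 1"
        by (rule shared_coloring[OF E b fin sym sq t tr m0 m(1) zk])
      then obtain y where y: "y \<in> ?Y" and yb: "\<And>k c. k < R \<Longrightarrow> c \<in> B \<Longrightarrow>
          op_bound (I c) (\<lambda>r s. \<Sum>i<n. y (i, k mod m i) * z k i * C i c r s) 1"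
        by blast
      have ysq: "y (i, k mod m i) * y (i, k mod m i) = 1" if "i < n" for i k
        using that m0 by (intro sign_square_one[OF y]) auto
      have ypm: "y (i, k mod m i) \<in> {-1, 1}" if "i < n" for i k
        using that m0 by (intro PiE_mem[OF y]) auto
      have zpm: "z k i \<in> {-1, 1}" if "i < n" "k < R" for i k
        using zk[OF that(2)] that(1) by (auto simp: sign_cube_def)
      have "\<Theta> y z k \<in> good" if "k < R" for k
      proof -
        have "y (i, k mod m i) * z k i \<in> {-1, 1}" if "i < n" for i
          using ypm[OF that, of k] zpm[OF that \<open>k < R\<close>] by auto
        then show ?thesis
          using yb[OF that] that unfolding good_def by (auto simp: \<Theta>_def sign_cube_def)
      qed
      then have "\<Theta> y z \<in> {..<R} \<rightarrow>\<^sub>E good" by (auto simp: \<Theta>_def)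
      moreover have "\<Theta> y (\<Theta> y z) = z"
      proof (rule ext, rule ext)
        fix k i
        show "\<Theta> y (\<Theta> y z) k i = z k i"
        proof (cases "k < R")
          case True
          have "z k i = undefined" if "\<not> i < n"
            using zk[OF True] that by (auto simp: sign_cube_def PiE_iff extensional_def)
          then show ?thesis
            using True ysq[of i k] by (auto simp: \<Theta>_def mult.assoc[symmetric])
        next
          case False
          then have "z k = undefined" using z by (auto simp: PiE_iff extensional_def)
          then show ?thesis using False by (simp add: \<Theta>_def)
        qed
      qed
      ultimately show "z \<in> (\<Union>y\<in>?Y. \<Theta> y ` ({..<R} \<rightarrow>\<^sub>E good))" using y by (intro UN_I[of y] image_eqI[of z _ "\<Theta> y z"]) simp_all
    qed
    moreover have finY: "finite ?Y" by (intro finite_PiE) auto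
    moreover have finG: "finite ({..<R} \<rightarrow>\<^sub>E good)" using good by (intro finite_PiE) auto
    ultimately have "card ({..<R} \<rightarrow>\<^sub>E sign_cube n) \<le> card (\<Union>y\<in>?Y. \<Theta> y ` ({..<R} \<rightarrow>\<^sub>E good))"
      by (intro card_mono) auto
    also have "\<dots> \<le> (\<Sum>y\<in>?Y. card (\<Theta> y ` ({..<R} \<rightarrow>\<^sub>E good)))" by (rule card_UN_le[OF finY])
    also have "\<dots> \<le> (\<Sum>y\<in>?Y. card ({..<R} \<rightarrow>\<^sub>E good))" by (intro sum_mono card_image_le finG)
    also have "\<dots> = 2 ^ card ?J * card good ^ R"
      by (simp add: card_funcsetE numeral_2_eq_2)
    finally have "real ((2 ^ n) ^ R) \<le> real (2 ^ card ?J * card good ^ R)"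
      unfolding of_nat_le_iff by (simp add: card_funcsetE card_sign_cube)
    then have le: "1 \<le> 2 ^ card ?J * p ^ R" by (simp add: p_def power_divide field_simps)
    have "p \<noteq> 0" using le R by (intro notI) (simp add: power_0_left)
    then have p0: "p > 0" by (simp add: p_def)
    have "0 \<le> ln (2 ^ card ?J * p ^ R)" using le by simp
    also have "\<dots> = card ?J * ln 2 + R * ln p" using p0 by (simp add: ln_mult ln_realpow)
    finally have 1: "R * - ln p \<le> card ?J * ln 2" by simp
    have "real (card ?J) = (\<Sum>i<n. real (m i))" by simp
    also have "\<dots> \<le> (\<Sum>i<n. 2 * real R * t i / b + 1)" using m by (intro sum_mono) auto
    also have "\<dots> = R * (2 * T / b + n / R)"
      using R by (simp add: T_def sum.distrib sum_distrib_left sum_divide_distrib algebra_simps)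
    finally have 2: "real (card ?J) \<le> R * (2 * T / b + n / R)" .
    have "R * - ln p \<le> R * (2 * T / b + n / R) * ln 2"
      by (rule order_trans[OF 1 mult_right_mono[OF 2]]) simp
    then have "R * - ln p \<le> R * ((2 * T / b + n / R) * ln 2)" by (simp only: mult.assoc)
    then have "- ln p \<le> (2 * T / b + n / R) * ln 2"
      by (rule mult_left_le_imp_le) (use R in simp)
    with p0 show ?thesis by blast
  qed
  \<comment> \<open>The bound on \<open>ln p\<close> holds for every number of copies; let it tend to infinity.\<close>
  have "(\<lambda>R. (2 * T / b + real n * inverse (real (Suc R))) * ln 2) \<longlonglongrightarrow> (2 * T / b + real n * 0) * ln 2"
    by (intro tendsto_intros LIMSEQ_inverse_real_of_nat)
  then have "- ln p \<le> (2 * T / b + real n * 0) * ln 2"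
  proof (rule LIMSEQ_le_const, intro exI allI impI)
    fix R :: nat
    show "- ln p \<le> (2 * T / b + real n * inverse (real (Suc R))) * ln 2"
      using key[of "Suc R"] unfolding divide_inverse by blast
  qed
  then have "- (2 * ln 2 / b) * T \<le> ln p" by (simp add: mult_ac)
  then have "exp (- (2 * ln 2 / b) * T) \<le> p" using key[of 1] by (subst ln_ge_iff[symmetric]) auto
  then show ?thesis by (simp add: p_def T_def)
qed

section \<open>Controlling the operator and the Frobenius norm together\<close>

text \<open>
  The matrix with blocks \<open>0\<close>, \<open>w\<^sup>T\<close>, \<open>w\<close>, \<open>0\<close>: index \<open>None\<close> is the border, \<open>Some u\<close> the coordinates of
  \<open>w\<close>. Its operator norm is the Euclidean norm of \<open>w\<close>, so it turns a Frobenius norm into an operator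
  norm.
\<close>
fun bordered :: "('u \<Rightarrow> real) \<Rightarrow> 'u option \<Rightarrow> 'u option \<Rightarrow> real" where
  "bordered w None (Some u) = w u"
| "bordered w (Some u) None = w u"
| "bordered w None None = 0"
| "bordered w (Some u) (Some v) = 0"

lemma bordered_symmetric: "bordered w r s = bordered w s r"
  by (cases r; cases s) auto

lemma sum_option: "finite U \<Longrightarrow> (\<Sum>t\<in>insert None (Some ` U). F t) = F None + (\<Sum>u\<in>U. F (Some u))"
  by (subst sum.insert) (auto simp: sum.reindex)

lemma bordered_energy:
  assumes "finite U"
  shows "(\<Sum>r\<in>insert None (Some ` U). \<Sum>s\<in>insert None (Some ` U). (bordered w r s)\<^sup>2) = 2 * (\<Sum>u\<in>U. (w u)\<^sup>2)"
  by (simp only: sum_option[OF assms] bordered.simps) simp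

text \<open>
  The square of a bordered matrix splits into the number \<open>\<bar>w\<bar>\<^sup>2\<close> at the border and the outer product
  \<open>w w\<^sup>T\<close>, so both parts of the sum of squares are bounded by \<open>\<Sum>\<^sub>i \<bar>w\<^sub>i\<bar>\<^sup>2\<close>.
\<close>
lemma op_bound_bordered_squares:
  assumes fin: "finite U" "finite J"
  shows "op_bound (insert None (Some ` U))
    (\<lambda>r s. \<Sum>i\<in>J. \<Sum>t\<in>insert None (Some ` U). bordered (w i) r t * bordered (w i) t s)
    (\<Sum>i\<in>J. \<Sum>u\<in>U. (w i u)\<^sup>2)"
proof -
  let ?X = "insert None (Some ` U)" and ?c = "\<Sum>i\<in>J. \<Sum>u\<in>U. (w i u)\<^sup>2"
  define Q where "Q r s = (\<Sum>i\<in>J. \<Sum>t\<in>?X. bordered (w i) r t * bordered (w i) t s)" for r s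
  have Q: "Q None None = ?c" "Q None (Some v) = 0" "Q (Some u) None = 0"
    "Q (Some u) (Some v) = (\<Sum>i\<in>J. w i u * w i v)" for u v
    by (simp_all only: Q_def sum_option[OF fin(1)] bordered.simps) (simp_all add: power2_eq_square)
  have "(\<Sum>u\<in>U. (\<Sum>v\<in>U. (\<Sum>i\<in>J. w i u * w i v) * f (Some v))\<^sup>2) \<le> ?c\<^sup>2 * (\<Sum>u\<in>U. (f (Some u))\<^sup>2)" for f
    by (rule op_boundD[OF op_bound_outer_products[OF fin(2)]])
  then have "op_bound ?X Q ?c"
    unfolding op_bound_def by (simp only: sum_option[OF fin(1)] Q) (simp add: power_mult_distrib distrib_left)
  then show ?thesis by (simp only: Q_def[abs_def])
qed

lemma op_bound_borderedD:
  assumes fin: "finite U" and bound: "op_bound (insert None (Some ` U)) (\<lambda>r s. \<Sum>i\<in>J. x i * bordered (w i) r s) c"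
  shows "(\<Sum>u\<in>U. (\<Sum>i\<in>J. x i * w i u)\<^sup>2) \<le> c\<^sup>2"
  using op_boundD[OF bound, of "\<lambda>t. if t = None then 1 else 0"] by (simp add: sum_option[OF fin])

lemma mat_trace_square_pairs: "symmetric_mat d H \<Longrightarrow> mat_trace (H * H) = (\<Sum>u\<in>{..<d}\<times>{..<d}. (H $$ u)\<^sup>2)"
  by (simp add: mat_trace_square sum.cartesian_product split_def)

text \<open>
  Two blocks are colored together: the block \<open>False\<close> consists of the matrices \<open>2 A\<^sub>i\<close> and enforces
  \<open>\<parallel>S\<^sub>x\<parallel> \<le> 1/2\<close>, the block \<open>True\<close> of bordered copies of \<open>c vec(A\<^sub>i)\<close> with \<open>c\<^sup>2 = a / \<tau>\<close> and
  enforces \<open>tr(S\<^sub>x\<^sup>2) \<le> \<tau> / a\<close>. This \<open>c\<close> is the largest for which the squares of the second block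
  satisfy the norm condition \<open>a\<close>. The trace of the pair is \<open>(4 + 2 c\<^sup>2) tr(A\<^sub>i\<^sup>2)\<close>, and \<open>\<tau> \<ge> 1/2\<close>
  makes the factor at most \<open>K\<close>.
\<close>
lemma many_balanced_colorings:
  fixes A :: "nat \<Rightarrow> real mat"
  assumes a: "a > 0" and b: "b > 0" and E: "coloring_property a b"
    and sym: "\<And>i. i < n \<Longrightarrow> symmetric_mat d (A i)"
    and sq: "op_norm (mat_sum d n (\<lambda>i. A i * A i)) \<le> a / 4"
    and K: "K = 4 + 4 * a"
    and tr: "\<And>i. i < n \<Longrightarrow> mat_trace (A i * A i) \<le> b / (2 * K)"
    and \<tau>: "\<tau> = (\<Sum>i<n. mat_trace (A i * A i))" "1 / 2 \<le> \<tau>"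
  defines "S \<equiv> signed_sum d n A"
  shows "exp (- (4 * K * ln 2 / b) * \<tau>)
    \<le> card {x \<in> sign_cube n. op_norm (S x) \<le> 1 / 2 \<and> mat_trace (S x * S x) \<le> \<tau> / a} / 2 ^ n"
    (is "_ \<le> real (card ?G) / _")
proof -
  define c where "c = sqrt (a / \<tau>)"
  have c2: "c\<^sup>2 = a / \<tau>" using a \<tau>(2) by (simp add: c_def)
  define U where "U = {..<d} \<times> {..<d}"
  have U: "finite U" by (simp add: U_def)
  have C: "A i \<in> carrier_mat d d" if "i < n" for i using sym[OF that] by (simp add: symmetric_mat_def)
  have K0: "K > 0" using K a by simp
  let ?tr = "\<lambda>i. mat_trace (A i * A i)"
  have tr0: "?tr i \<ge> 0" if "i < n" for i by (simp add: mat_trace_square[OF sym[OF that]] sum_nonneg)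
  \<comment> \<open>Both blocks need one index type; the rows of \<open>A\<^sub>i\<close> are embedded into that of the bordered block.\<close>
  define e :: "nat \<Rightarrow> (nat \<times> nat) option" where "e p = Some (p, 0)" for p
  have e: "bij_betw e {..<d} (e ` {..<d})" by (auto simp: bij_betw_def inj_on_def e_def)
  define row where "row = (\<lambda>r::(nat \<times> nat) option. fst (the r))"
  have row [simp]: "row (e p) = p" for p by (simp add: row_def e_def)
  define I where "I k = (if k then insert None (Some ` U) else e ` {..<d})" for k
  define M where "M i k = (if k then bordered (\<lambda>u. c * A i $$ u) else (\<lambda>r s. 2 * A i $$ (row r, row s)))" for i k
  define t where "t i = (4 + 2 * c\<^sup>2) * ?tr i" for i
  let ?good = "{x \<in> sign_cube n. \<forall>k\<in>UNIV. op_bound (I k) (\<lambda>r s. \<Sum>i<n. x i * M i k r s) 1}"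
  have tK: "t i \<le> K * ?tr i" if "i < n" for i
  proof -
    have "c\<^sup>2 \<le> 2 * a" unfolding c2 using a \<tau>(2) by (simp add: field_simps)
    then show ?thesis unfolding t_def using tr0[OF that] by (intro mult_right_mono) (auto simp: K)
  qed
  have "exp (- (2 * ln 2 / b) * (\<Sum>i<n. t i)) \<le> card ?good / 2 ^ n"
  proof (rule many_colorings[OF E _ b])
    show "a \<ge> 0" using a by simp
    show "finite (UNIV :: bool set)" "finite (I k)" for k using U by (auto simp: I_def)
    show "M i k r s = M i k s r" if "i < n" "r \<in> I k" "s \<in> I k" for i k r s
      using that symmetric_mat_entry[OF sym[OF that(1)]]
      by (auto simp: M_def I_def bordered_symmetric[of _ r s] split: if_splits)
    show "op_bound (I k) (\<lambda>r s. \<Sum>i<n. \<Sum>u\<in>I k. M i k r u * M i k u s) a" for k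
    proof (cases k)
      case True
      have "(\<Sum>i<n. \<Sum>u\<in>U. (c * A i $$ u)\<^sup>2) = c\<^sup>2 * \<tau>"
        unfolding \<tau>(1) sum_distrib_left
        by (intro sum.cong refl) (simp add: mat_trace_square_pairs[OF sym] U_def power_mult_distrib sum_distrib_left)
      also have "\<dots> = a" unfolding c2 using \<tau>(2) by simp
      finally show ?thesis
        using op_bound_bordered_squares[OF U finite_lessThan, of "\<lambda>i u. c * A i $$ u" n] True
        by (simp add: I_def M_def)
    next
      case False
      let ?Q = "mat_sum d n (\<lambda>i. A i * A i)"
      have "op_bound {..<d} (\<lambda>r s. ?Q $$ (r, s)) (a / 4)"
        using sq a by (subst op_norm_le_iff[symmetric]) auto
      from op_bound_scale[OF this, of 4] have "op_bound {..<d} (\<lambda>r s. 4 * ?Q $$ (r, s)) a" by simp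
      then have "op_bound {..<d} (\<lambda>r s. \<Sum>i<n. \<Sum>u\<in>I k. M i k (e r) u * M i k u (e s)) a"
      proof (rule iffD1[OF op_bound_cong, rotated])
        fix r s assume rs: "r \<in> {..<d}" "s \<in> {..<d}"
        have "?Q $$ (r, s) = (\<Sum>i<n. (A i * A i) $$ (r, s))" using rs by (simp add: mat_sum_def)
        also have "\<dots> = (\<Sum>i<n. \<Sum>u<d. A i $$ (r, u) * A i $$ (u, s))"
          using rs by (intro sum.cong refl) (simp add: mat_mult_entry[OF C C] del: index_mult_mat)
        finally show "4 * ?Q $$ (r, s) = (\<Sum>i<n. \<Sum>u\<in>I k. M i k (e r) u * M i k u (e s))"
          using False by (simp add: I_def M_def sum_distrib_left mult_ac
              sum.reindex_bij_betw[OF e, symmetric])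
      qed
      then show ?thesis
        using False op_bound_reindex[OF e, of "\<lambda>r s. \<Sum>i<n. \<Sum>u\<in>I k. M i k r u * M i k u s"]
        by (simp add: I_def)
    qed
    show "t i = (\<Sum>k\<in>UNIV. \<Sum>r\<in>I k. \<Sum>s\<in>I k. (M i k r s)\<^sup>2)" if "i < n" for i
    proof -
      have "(\<Sum>r\<in>I True. \<Sum>s\<in>I True. (M i True r s)\<^sup>2) = 2 * c\<^sup>2 * ?tr i"
        by (simp only: I_def M_def if_True bordered_energy[OF U] mat_trace_square_pairs[OF sym[OF that]])
           (simp add: U_def power_mult_distrib sum_distrib_left mult.assoc)
      moreover have "(\<Sum>r\<in>I False. \<Sum>s\<in>I False. (M i False r s)\<^sup>2) = 4 * ?tr i"
        by (simp add: I_def M_def mat_trace_square[OF sym[OF that]]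
            power_mult_distrib sum_distrib_left sum.reindex_bij_betw[OF e, symmetric])
      ultimately show ?thesis by (simp add: UNIV_bool t_def algebra_simps)
    qed
    show "t i \<le> b / 2" if "i < n" for i
      using tK[OF that] tr[OF that] K0 by (simp add: field_simps)
  qed
  also have "\<dots> \<le> card ?G / 2 ^ n"
  proof -
    have "?good \<subseteq> ?G"
    proof
      fix x assume x: "x \<in> ?good"
      have Sx: "S x $$ (r, s) = (\<Sum>i<n. x i * A i $$ (r, s))" if "r < d" "s < d" for r s
        using signed_sum_entry[OF C that] by (simp add: S_def)
      have "op_bound (I False) (\<lambda>r s. \<Sum>i<n. x i * M i False r s) 1" using x by blast
      then have "op_bound {..<d} (\<lambda>r s. \<Sum>i<n. x i * M i False (e r) (e s)) 1"
        using op_bound_reindex[OF e, of "\<lambda>r s. \<Sum>i<n. x i * M i False r s"] by (simp add: I_def)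
      from op_bound_scale[OF this, of "1 / 2"]
      have "op_bound {..<d} (\<lambda>r s. S x $$ (r, s)) (1 / 2)"
        by (subst op_bound_cong[of _ _ "\<lambda>r s. 1 / 2 * (\<Sum>i<n. x i * M i False (e r) (e s))"])
           (auto simp: Sx M_def sum_distrib_left)
      then have 1: "op_norm (S x) \<le> 1 / 2"
        by (subst op_norm_le_iff[of _ d]) (auto simp: S_def)
      have "op_bound (I True) (\<lambda>r s. \<Sum>i<n. x i * M i True r s) 1" using x by blast
      then have "(\<Sum>u\<in>U. (\<Sum>i<n. x i * (c * A i $$ u))\<^sup>2) \<le> 1"
        using op_bound_borderedD[OF U, where J = "{..<n}" and x = x and w = "\<lambda>i u. c * A i $$ u" and c = 1] by (simp add: I_def M_def)
      also have "(\<Sum>u\<in>U. (\<Sum>i<n. x i * (c * A i $$ u))\<^sup>2) = (\<Sum>u\<in>U. (c * S x $$ u)\<^sup>2)"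
        by (intro sum.cong refl arg_cong[of _ _ "\<lambda>y. y\<^sup>2"])
           (auto simp: U_def Sx sum_distrib_left mult_ac)
      also have "\<dots> = c\<^sup>2 * mat_trace (S x * S x)"
        using mat_trace_square_pairs[OF signed_sum_symmetric[OF sym]]
        by (simp add: S_def U_def power_mult_distrib sum_distrib_left)
      finally have "mat_trace (S x * S x) \<le> \<tau> / a"
        unfolding c2 using a \<tau>(2) by (simp add: field_simps)
      with 1 x show "x \<in> ?G" by blast
    qed
    then have "card ?good \<le> card ?G" by (intro card_mono) auto
    then show ?thesis by (simp add: divide_right_mono)
  qed
  finally have good: "exp (- (2 * ln 2 / b) * (\<Sum>i<n. t i)) \<le> card ?G / 2 ^ n" .
  have \<tau>K: "(\<Sum>i<n. t i) \<le> K * \<tau>"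
    unfolding \<tau>(1) sum_distrib_left using tK by (intro sum_mono) auto
  have "(2 * ln 2 / b) * (\<Sum>i<n. t i) \<le> (4 * ln 2 / b) * (K * \<tau>)"
    using b K0 \<tau> \<tau>K by (intro mult_mono) (auto simp: divide_right_mono t_def intro!: sum_nonneg mult_nonneg_nonneg tr0)
  then have "- (4 * K * ln 2 / b) * \<tau> \<le> - (2 * ln 2 / b) * (\<Sum>i<n. t i)" by (simp add: mult_ac)
  then have "exp (- (4 * K * ln 2 / b) * \<tau>) \<le> exp (- (2 * ln 2 / b) * (\<Sum>i<n. t i))" by simp
  with good show ?thesis by linarith
qed

section \<open>Small total energy\<close>

text \<open>
  For \<open>i \<noteq> j\<close>, flipping the sign of coordinate \<open>i\<close> is an involution of the cube that negates the
  summand.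
\<close>
lemma sum_sign_cube_product:
  assumes "i < n" "j < n"
  shows "(\<Sum>x\<in>sign_cube n. x i * x j) = (if i = j then 2 ^ n else 0)"
proof (cases "i = j")
  case True
  have "(\<Sum>x\<in>sign_cube n. x i * x j) = (\<Sum>x\<in>sign_cube n. 1)"
    using sign_square_one[of _ "{..<n}" i] assms True by (intro sum.cong refl) (auto simp: sign_cube_def)
  then show ?thesis using True by (simp add: card_sign_cube)
next
  case False
  let ?flip = "\<lambda>x::nat \<Rightarrow> real. x(i := - x i)"
  have fl: "?flip x \<in> sign_cube n" if "x \<in> sign_cube n" for x
    using that assms by (auto simp: sign_cube_def PiE_iff extensional_def)
  have "(\<Sum>x\<in>sign_cube n. x i * x j) = (\<Sum>x\<in>sign_cube n. - (x i * x j))"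
    by (rule sum.reindex_bij_witness[of _ ?flip ?flip]) (use fl False in auto)
  then show ?thesis using False by (simp add: sum_negf)
qed

lemma sum_sign_cube_square:
  "(\<Sum>x\<in>sign_cube n. (\<Sum>i<n. x i * \<alpha> i)\<^sup>2) = 2 ^ n * (\<Sum>i<n. (\<alpha> i)\<^sup>2)"
proof -
  have "(\<Sum>x\<in>sign_cube n. (\<Sum>i<n. x i * \<alpha> i)\<^sup>2)
      = (\<Sum>x\<in>sign_cube n. \<Sum>i<n. \<Sum>j<n. \<alpha> i * \<alpha> j * (x i * x j))"
    by (simp add: power2_eq_square sum_product mult_ac)
  also have "\<dots> = (\<Sum>i<n. \<Sum>j<n. \<alpha> i * \<alpha> j * (\<Sum>x\<in>sign_cube n. x i * x j))"
    unfolding sum_distrib_left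
    by (subst sum.swap, intro sum.cong refl, subst sum.swap, rule refl)
  also have "\<dots> = (\<Sum>i<n. \<Sum>j<n. if i = j then 2 ^ n * (\<alpha> i)\<^sup>2 else 0)"
    by (intro sum.cong refl) (simp add: sum_sign_cube_product power2_eq_square)
  finally show ?thesis by (simp add: sum_distrib_left)
qed

lemma expectation_unif_cube:
  fixes f :: "(nat \<Rightarrow> real) \<Rightarrow> real"
  shows
  "measure_pmf.expectation (unif_cube n) f = (\<Sum>x\<in>sign_cube n. f x) / 2 ^ n"
  unfolding unif_cube_def by (subst integral_pmf_of_set) (auto simp: card_sign_cube)

lemma sum_trace_signed_sum:
  assumes sym: "\<And>i. i < n \<Longrightarrow> symmetric_mat d (A i)"
  shows "(\<Sum>x\<in>sign_cube n. mat_trace (signed_sum d n A x * signed_sum d n A x))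
    = 2 ^ n * (\<Sum>i<n. mat_trace (A i * A i))"
proof -
  have C: "A i \<in> carrier_mat d d" if "i < n" for i
    using sym[OF that] by (simp add: symmetric_mat_def)
  have "(\<Sum>x\<in>sign_cube n. mat_trace (signed_sum d n A x * signed_sum d n A x))
      = (\<Sum>x\<in>sign_cube n. \<Sum>r<d. \<Sum>s<d. (\<Sum>i<n. x i * A i $$ (r, s))\<^sup>2)"
    by (intro sum.cong refl)
       (simp add: mat_trace_square[OF signed_sum_symmetric[OF sym]] signed_sum_entry[OF C])
  also have "\<dots> = (\<Sum>r<d. \<Sum>s<d. \<Sum>x\<in>sign_cube n. (\<Sum>i<n. x i * A i $$ (r, s))\<^sup>2)"
    by (subst sum.swap, intro sum.cong refl, subst sum.swap, rule refl)
  also have "\<dots> = (\<Sum>r<d. \<Sum>s<d. 2 ^ n * (\<Sum>i<n. (A i $$ (r, s))\<^sup>2))"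
    by (simp only: sum_sign_cube_square)
  also have "\<dots> = 2 ^ n * (\<Sum>r<d. \<Sum>s<d. \<Sum>i<n. (A i $$ (r, s))\<^sup>2)"
    by (simp add: sum_distrib_left)
  also have "(\<Sum>r<d. \<Sum>s<d. \<Sum>i<n. (A i $$ (r, s))\<^sup>2) = (\<Sum>i<n. \<Sum>r<d. \<Sum>s<d. (A i $$ (r, s))\<^sup>2)"
    by (subst (2) sum.swap, subst (1) sum.swap, rule refl)
  also have "\<dots> = (\<Sum>i<n. mat_trace (A i * A i))"
    by (intro sum.cong refl) (simp add: mat_trace_square[OF sym])
  finally show ?thesis .
qed

text \<open>
  The tangent form of Jensen's inequality for powers. The point \<open>w = 0\<close> is included because \<open>W\<close>
  vanishes on matrices of norm at least 1.
\<close>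
lemma powr_above_tangent:
  fixes u w \<gamma> :: real
  assumes "u > 0" "w \<ge> 0" "\<gamma> \<ge> 1"
  shows "u powr \<gamma> + \<gamma> * u powr (\<gamma> - 1) * (w - u) \<le> w powr \<gamma>"
proof (cases "w = 0")
  case True
  have "u powr \<gamma> = u powr (\<gamma> - 1) * u" using assms by (simp add: powr_diff)
  then show ?thesis using True assms by (simp add: mult_right_mono mult_ac)
next
  case False
  have "\<gamma> * u powr (\<gamma> - 1) * (w - u) \<le> w powr \<gamma> - u powr \<gamma>"
    using assms False
    by (intro convex_on_imp_above_tangent[OF powr_convex, of \<gamma>])
       (auto intro!: derivative_eq_intros simp: interior_open)
  then show ?thesis by simp
qed

text \<open>
  First moment bound. The expectation of \<open>W 1\<close> is at least \<open>1 - \<tau>\<close>, and \<open>1 - \<tau> \<ge> e\<^bsup>-2\<tau>\<^esup>\<close> for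
  \<open>\<tau> \<le> 1/2\<close>. Powers \<open>\<beta> \<le> 1\<close> increase numbers in \<open>[0, 1]\<close>, so the exponent can be replaced by
  \<open>max 1 \<beta>\<close>, and the tangent of the power at \<open>1 - \<tau>\<close> then has nonnegative slope.
\<close>
lemma W_expectation_small_energy:
  assumes sym: "\<And>i. i < n \<Longrightarrow> symmetric_mat d (A i)"
    and \<tau>: "\<tau> = (\<Sum>i<n. mat_trace (A i * A i))" "\<tau> \<le> 1 / 2" and \<beta>: "\<beta> > 0"
  shows "exp (- 2 * max 1 \<beta> * \<tau>)
    \<le> measure_pmf.expectation (unif_cube n) (\<lambda>x. W \<beta> (signed_sum d n A x))"
proof -
  let ?S = "signed_sum d n A"
  let ?\<gamma> = "max 1 \<beta>"
  define w where "w x = W 1 (?S x)" for x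
  note S = signed_sum_symmetric[OF sym]
  have w: "0 \<le> w x" "w x \<le> 1" "1 - mat_trace (?S x * ?S x) \<le> w x" for x
    using W_bounds[OF S] by (auto simp: w_def)
  have \<tau>0: "0 \<le> \<tau>" unfolding \<tau> by (intro sum_nonneg) (simp add: mat_trace_square[OF sym] sum_nonneg)
  let ?u = "1 - \<tau>" and ?E = "measure_pmf.expectation (unif_cube n)"
  have "?u = (\<Sum>x\<in>sign_cube n. 1 - mat_trace (?S x * ?S x)) / 2 ^ n"
    by (simp add: sum_subtractf sum_trace_signed_sum[OF sym] \<tau> card_sign_cube diff_divide_distrib)
  also have "\<dots> \<le> ?E w"
    unfolding expectation_unif_cube using w by (intro divide_right_mono sum_mono) auto
  finally have E: "?u \<le> ?E w" .
  have "- 2 * \<tau> \<le> - \<tau> - 2 * \<tau>\<^sup>2 + \<tau> * (2 * \<tau> - 1)" by (simp add: algebra_simps power2_eq_square)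
  also have "\<dots> \<le> - \<tau> - 2 * \<tau>\<^sup>2" using \<tau>0 \<tau>(2) by (simp add: mult_nonneg_nonpos)
  also have "\<dots> \<le> ln ?u" using \<tau>0 \<tau>(2) by (rule ln_one_minus_pos_lower_bound)
  finally have "exp (- 2 * \<tau>) \<le> ?u" using \<tau>(2) by (subst ln_ge_iff[symmetric]) auto
  then have "exp (- 2 * \<tau>) powr ?\<gamma> \<le> ?u powr ?\<gamma>" by (intro powr_mono2) auto
  also have "\<dots> \<le> ?u powr ?\<gamma> + ?\<gamma> * ?u powr (?\<gamma> - 1) * (?E w - ?u)"
    using E by simp
  also have "\<dots> = ?E (\<lambda>x. ?u powr ?\<gamma> + ?\<gamma> * ?u powr (?\<gamma> - 1) * (w x - ?u))"
    by (simp add: expectation_unif_cube sum.distrib sum_subtractf card_sign_cube add_divide_distrib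
        diff_divide_distrib right_diff_distrib flip: sum_distrib_left)
  also have "\<dots> \<le> ?E (\<lambda>x. w x powr ?\<gamma>)"
    unfolding expectation_unif_cube using w \<tau>(2)
    by (intro divide_right_mono sum_mono powr_above_tangent) auto
  also have "\<dots> \<le> ?E (\<lambda>x. w x powr \<beta>)"
    unfolding expectation_unif_cube using w by (intro divide_right_mono sum_mono powr_mono') auto
  also have "\<dots> = ?E (\<lambda>x. W \<beta> (?S x))"
    by (simp add: W_eq_powr[OF S, where \<beta> = \<beta>] w_def)
  finally show ?thesis by (simp add: powr_def mult_ac)
qed

section \<open>Relative entropy of a conditional law and the conclusion\<close>

text \<open>
  The density of the conditional law is the constant \<open>1 / P(G)\<close> on \<open>G\<close>.
\<close>
lemma rel_entropy_cond_pmf: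
  assumes "set_pmf p \<inter> G \<noteq> {}"
  shows "rel_entropy (cond_pmf p G) p = - ln (measure_pmf.prob p G)"
proof -
  let ?P = "measure_pmf.prob p G"
  have P: "?P > 0" using measure_measure_pmf_not_zero[OF assms] by (simp add: zero_less_measure_iff)
  define f where "f x = indicator G x / ?P" for x
  have "measure_pmf (cond_pmf p G) = density (measure_pmf p) (\<lambda>x. ennreal (f x))"
    unfolding cond_pmf.rep_eq[OF assms] uniform_measure_def f_def
    by (intro density_cong)
       (auto simp: measure_pmf.emeasure_eq_measure divide_ennreal P ennreal_indicator[symmetric] simp del: ennreal_indicator)
  then have "rel_entropy (cond_pmf p G) p = (\<integral>x. f x * log (exp 1) (f x) \<partial>measure_pmf p)"
    unfolding rel_entropy_def using P by (simp only:, intro sigma_finite_measure.KL_density prob_space_imp_sigma_finite prob_space_measure_pmf) (auto simp: f_def)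
  also have "(\<lambda>x. f x * log (exp 1) (f x)) = (\<lambda>x. indicator G x * (- ln ?P / ?P))"
    using P by (auto simp: f_def log_def ln_div indicator_def)
  also have "(\<integral>x. indicator G x * (- ln ?P / ?P) \<partial>measure_pmf p) = - ln ?P" using P by simp
  finally show ?thesis .
qed

theorem theorem3p6:
  fixes a b K h C\<^sub>a\<^sub>b \<tau> :: real
    and d n :: nat
    and A :: "nat \<Rightarrow> real mat"
    and S :: "(nat \<Rightarrow> real) \<Rightarrow> real mat"
    and G :: "(nat \<Rightarrow> real) set"
    and \<mu> :: "(nat \<Rightarrow> real) pmf"
  assumes "a > 0" and "b > 0"
    and "coloring_property a b"
    and "K = 4 + 4 * a"
    and "h = 4 * K * ln 2 / b"
    and "C\<^sub>a\<^sub>b = max 2 (h + 4 / (3 * a))"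
    and "\<And>i. i < n \<Longrightarrow> symmetric_mat d (A i)"
    and "op_norm (mat_sum d n (\<lambda>i. A i * A i)) \<le> a / 4"
    and "\<And>i. i < n \<Longrightarrow> mat_trace (A i * A i) \<le> b / (2 * K)"
    and "\<And>x. S x = signed_sum d n A x"
    and "\<tau> = (\<Sum>i<n. mat_trace (A i * A i))"
    and "G = {x \<in> sign_cube n. op_norm (S x) \<le> 1 / 2 \<and> mat_trace (S x * S x) \<le> \<tau> / a}"
    and "\<mu> = cond_pmf (unif_cube n) G"
  shows "(\<forall>\<beta>>0. measure_pmf.expectation (unif_cube n) (\<lambda>x. W \<beta> (S x))
                   \<ge> exp (- C\<^sub>a\<^sub>b * max 1 \<beta> * \<tau>)) \<and>
         (\<tau> \<ge> 1 / 2 \<longrightarrow>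
            measure_pmf.prob (unif_cube n) G \<ge> exp (- h * \<tau>) \<and>
            rel_entropy \<mu> (unif_cube n) \<le> h * \<tau> \<and>
            ext_expectation \<mu> (\<lambda>x. Phi (S x)) \<le> ennreal (4 * \<tau> / (3 * a)))"
proof -
  note a = assms(1) and b = assms(2) and E = assms(3) and K = assms(4) and h = assms(5)
    and Cab = assms(6) and sym = assms(7) and sq = assms(8) and tr = assms(9)
    and S = assms(10) and \<tau> = assms(11) and G = assms(12) and \<mu> = assms(13)
  let ?U = "unif_cube n" and ?P = "measure_pmf.prob (unif_cube n) G"
  have symS: "symmetric_mat d (S x)" for x unfolding S by (rule signed_sum_symmetric[OF sym])
  have \<tau>0: "\<tau> \<ge> 0" unfolding \<tau> by (intro sum_nonneg) (simp add: mat_trace_square[OF sym] sum_nonneg)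
  have h0: "h \<ge> 0" unfolding h K using a b by simp
  have GU: "G \<subseteq> sign_cube n" unfolding G by blast
  have P: "?P = card G / 2 ^ n"
    using GU by (simp add: unif_cube_def measure_pmf_of_set card_sign_cube Int_absorb1)
  have PG: "exp (- h * \<tau>) \<le> ?P" if "\<tau> \<ge> 1 / 2"
    unfolding P unfolding G h S using many_balanced_colorings[OF a b E sym sq K tr \<tau> that] by simp
  have trG: "4 / 3 * mat_trace (S x * S x) \<le> 4 * \<tau> / (3 * a)" if "x \<in> G" for x
    using that a unfolding G by (simp add: field_simps)
  have W: "exp (- C\<^sub>a\<^sub>b * max 1 \<beta> * \<tau>) \<le> measure_pmf.expectation ?U (\<lambda>x. W \<beta> (S x))" if \<beta>: "\<beta> > 0" for \<beta>
  proof (cases "\<tau> \<ge> 1 / 2")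
    case False
    have "2 * (max 1 \<beta> * \<tau>) \<le> C\<^sub>a\<^sub>b * (max 1 \<beta> * \<tau>)"
      using \<tau>0 by (intro mult_right_mono) (auto simp: Cab)
    then have "exp (- C\<^sub>a\<^sub>b * max 1 \<beta> * \<tau>) \<le> exp (- 2 * max 1 \<beta> * \<tau>)" by (simp add: mult.assoc)
    also have "\<dots> \<le> measure_pmf.expectation ?U (\<lambda>x. W \<beta> (S x))"
      unfolding S using W_expectation_small_energy[OF sym \<tau> _ \<beta>] False by simp
    finally show ?thesis .
  next
    case True
    have "(h + \<beta> * (4 / (3 * a))) * \<tau> \<le> (h + 4 / (3 * a)) * max 1 \<beta> * \<tau>"
    proof (intro mult_right_mono \<tau>0)
      have "h + \<beta> * g \<le> (h + g) * max 1 \<beta>" if "g \<ge> 0" for g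
        using mult_left_mono[of 1 "max 1 \<beta>" h] mult_right_mono[of \<beta> "max 1 \<beta>" g] h0 that
        by (simp add: algebra_simps)
      then show "h + \<beta> * (4 / (3 * a)) \<le> (h + 4 / (3 * a)) * max 1 \<beta>" by this (use a in simp)
    qed
    also have "\<dots> \<le> C\<^sub>a\<^sub>b * max 1 \<beta> * \<tau>"
      using \<tau>0 by (intro mult_right_mono) (auto simp: Cab)
    finally have "exp (- C\<^sub>a\<^sub>b * max 1 \<beta> * \<tau>) \<le> exp (- h * \<tau> + - \<beta> * (4 * \<tau> / (3 * a)))"
      by (simp add: algebra_simps)
    also have "\<dots> = exp (- h * \<tau>) * exp (- \<beta> * (4 * \<tau> / (3 * a)))" by (simp only: exp_add)
    also have "\<dots> \<le> ?P * exp (- \<beta> * (4 * \<tau> / (3 * a)))"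
      using PG[OF True] by (intro mult_right_mono) auto
    also have "\<dots> = (\<Sum>x\<in>G. exp (- \<beta> * (4 * \<tau> / (3 * a)))) / 2 ^ n" by (simp add: P)
    also have "\<dots> \<le> (\<Sum>x\<in>G. W \<beta> (S x)) / 2 ^ n"
    proof (intro divide_right_mono sum_mono)
      fix x assume x: "x \<in> G"
      have "\<beta> * (4 / 3 * mat_trace (S x * S x)) \<le> \<beta> * (4 * \<tau> / (3 * a))"
        using trG[OF x] \<beta> by (intro mult_left_mono) auto
      then have "exp (- \<beta> * (4 * \<tau> / (3 * a))) \<le> exp (- \<beta> * (4 / 3 * mat_trace (S x * S x)))" by simp
      also have "\<dots> \<le> W \<beta> (S x)" using x unfolding G by (intro W_ge_exp[OF symS _ \<beta>]) blast
      finally show "exp (- \<beta> * (4 * \<tau> / (3 * a))) \<le> W \<beta> (S x)" .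
    qed simp
    also have "\<dots> \<le> (\<Sum>x\<in>sign_cube n. W \<beta> (S x)) / 2 ^ n"
      using GU by (intro divide_right_mono sum_mono2) (auto simp: W_eq_powr[OF symS, where \<beta> = \<beta>])
    finally show ?thesis by (simp add: expectation_unif_cube)
  qed
  have ent: "rel_entropy \<mu> ?U \<le> h * \<tau>"
    and Phi: "ext_expectation \<mu> (\<lambda>x. Phi (S x)) \<le> ennreal (4 * \<tau> / (3 * a))" if "\<tau> \<ge> 1 / 2"
  proof -
    have pos: "?P > 0" using PG[OF that] by (meson exp_gt_zero less_le_trans)
    then have "G \<noteq> {}" by auto
    then have ne: "set_pmf ?U \<inter> G \<noteq> {}" using GU by (auto simp: unif_cube_def)
    have "- h * \<tau> \<le> ln ?P" using PG[OF that] pos by (subst ln_ge_iff) auto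
    then show "rel_entropy \<mu> ?U \<le> h * \<tau>" by (simp add: \<mu> rel_entropy_cond_pmf[OF ne])
    have "e2ennreal (Phi (S x)) \<le> ennreal (4 * \<tau> / (3 * a))" if "x \<in> G" for x
    proof -
      have "Phi (S x) \<le> ereal (4 * \<tau> / (3 * a))"
        using Phi_le[OF symS, of x] trG[OF that] that unfolding G by (auto intro: order_trans)
      then have "e2ennreal (Phi (S x)) \<le> e2ennreal (ereal (4 * \<tau> / (3 * a)))" by (rule e2ennreal_mono)
      then show ?thesis by simp
    qed
    then have "ext_expectation \<mu> (\<lambda>x. Phi (S x)) \<le> (\<integral>\<^sup>+ x. ennreal (4 * \<tau> / (3 * a)) \<partial>measure_pmf \<mu>)"
      unfolding ext_expectation_def using ne
      by (intro nn_integral_mono_AE) (auto simp: AE_measure_pmf_iff \<mu>)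
    then show "ext_expectation \<mu> (\<lambda>x. Phi (S x)) \<le> ennreal (4 * \<tau> / (3 * a))" by simp
  qed
  show ?thesis using W PG ent Phi by blast
qed

end
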